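(* Let $k\ge1$ and let $y=(y_w)_{\deg w\le 2k}$ be a truncated tracial sequence of order $2k$. If $M_k(y)$ is positive semidefinite and $M_k(y)$ is a flat extension of $M_{k-1}(y)$, then $y$ is a truncated tracial moment sequence.
   Context: Let $\langle\underline X\rangle$ be the free monoid of words in the non-commuting letters $\underline X=(X_1,\dots,X_n)$, with empty word $\emptyset=1$. For a word $w$, $w^*$ is the reversed word and $\deg w$ its length. Two words are cyclically equivalent, $w\overset{\mathrm{cyc}}{\sim}u$, if $u$ is a cyclic permutation of $w$. $\operatorname{Tr}(A)=\frac1s\operatorname{tr}(A)$ for $A\in\mathbb R^{s\times s}$ is the normalized trace. A truncated tracial sequence of order $m$ is a family of real numbers $(y_w)$ indexed by the words $w$ with $\deg w\le m$ such that $y_w=y_u$ whenever $w\overset{\mathrm{cyc}}{\sim}u$, $y_w=y_{w^*}$ for all such $w$, and $y_\emptyset=1$. For $2k\le m$, its tracial moment matrix of order $k$ is $M_k(y)=(y_{u^*v})_{u,v}$, indexed by words $u,v$ with $\deg u,\deg v\le k$. A truncated tracial sequence $y$ of order $m$ is a truncated tracial moment sequence if there are $N,s\in\mathbb N$, $\lambda_i\in\mathbb R_{\ge0}$ with $\sum_{i=1}^N\lambda_i=1$, and tuples $\underline A^{(i)}$ of $n$ real symmetric $s\times s$ matrices such that $y_w=\sum_{i=1}^N\lambda_i\operatorname{Tr}(w(\underline A^{(i)}))$ for all words $w$ with $\deg w\le m$. A symmetric matrix $\tilde A=\begin{pmatrix} A & B \\ {B}^* & C \end{pmatrix}$ is a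 flat extension of the symmetric matrix $A$ if $\operatorname{rank}A=\operatorname{rank}\tilde A$. *)

theory Defs
  imports "Jordan_Normal_Form.DL_Rank"
begin

text \<open>The letters \<open>X\<^sub>1, \<dots>, X\<^sub>n\<close> are encoded by the numbers \<open>0, \<dots>, n - 1\<close>; a word is a list of
  letters, its degree is its length and \<^term>\<open>rev w\<close> is the involution \<open>w\<^sup>*\<close>.\<close>

definition words :: "nat \<Rightarrow> nat \<Rightarrow> nat list set" where
  "words n d = {w. set w \<subseteq> {..<n} \<and> length w \<le> d}"

definition cyc_equiv :: "nat list \<Rightarrow> nat list \<Rightarrow> bool" where
  "cyc_equiv w u \<longleftrightarrow> (\<exists>r. u = rotate r w)"

text \<open>A truncated sequence is a total function on lists, of which only the values on
  \<^term>\<open>words n m\<close> are ever used.\<close>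

definition truncated_tracial_sequence :: "nat \<Rightarrow> nat \<Rightarrow> (nat list \<Rightarrow> real) \<Rightarrow> bool" where
  "truncated_tracial_sequence n m y \<longleftrightarrow>
     (\<forall>w \<in> words n m. \<forall>u \<in> words n m. cyc_equiv w u \<longrightarrow> y w = y u) \<and>
     (\<forall>w \<in> words n m. y w = y (rev w)) \<and>
     y [] = 1"

text \<open>Matrices are indexed by numbers, so the words of degree at most \<open>d\<close> are enumerated, by
  increasing degree. Hence the enumeration for \<open>d\<close> is an initial segment of the one for \<open>d + 1\<close>, and
  the moment matrix of order \<open>k\<close> is a leading principal block of the one of order \<open>k + 1\<close>.\<close>

definition word_list :: "nat \<Rightarrow> nat \<Rightarrow> nat list list" where
  "word_list n d = concat (map (\<lambda>e. List.n_lists e [0..<n]) [0..<Suc d])"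

lemma set_word_list: "set (word_list n d) = words n d"
  by (auto simp: word_list_def words_def set_n_lists atLeast0LessThan less_Suc_eq_le)

lemma word_list_Suc: "word_list n (Suc d) = word_list n d @ List.n_lists (Suc d) [0..<n]"
  by (simp add: word_list_def)

lemma distinct_word_list: "distinct (word_list n d)"
proof (induction d)
  case 0
  then show ?case by (simp add: word_list_def)
next
  case (Suc d)
  have "set (word_list n d) \<inter> set (List.n_lists (Suc d) [0..<n]) = {}"
    unfolding set_word_list by (auto simp: words_def set_n_lists)
  moreover have "distinct (List.n_lists (Suc d) [0..<n])"
    by (rule distinct_n_lists) simp
  ultimately show ?case
    unfolding word_list_Suc distinct_append using Suc by blast
qed

definition tracial_moment_matrix :: "nat \<Rightarrow> nat \<Rightarrow> (nat list \<Rightarrow> real) \<Rightarrow> real mat" where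
  "tracial_moment_matrix n k y =
     mat (length (word_list n k)) (length (word_list n k))
       (\<lambda>(i, j). y (rev (word_list n k ! i) @ (word_list n k ! j)))"

text \<open>The equation below forces the matrix to be square.\<close>

definition symmetric_mat :: "real mat \<Rightarrow> bool" where
  "symmetric_mat A \<longleftrightarrow> transpose_mat A = A"

definition psd_mat :: "real mat \<Rightarrow> bool" where
  "psd_mat A \<longleftrightarrow> symmetric_mat A \<and>
     (\<forall>v \<in> carrier_vec (dim_row A). 0 \<le> v \<bullet> (A *\<^sub>v v))"

definition mat_rank :: "real mat \<Rightarrow> nat" where
  "mat_rank A = vec_space.rank (dim_row A) A"

definition flat_extension :: "real mat \<Rightarrow> real mat \<Rightarrow> bool" where
  "flat_extension A' A \<longleftrightarrow> symmetric_mat A' \<and> symmetric_mat A \<and>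
     (\<exists>B C. B \<in> carrier_mat (dim_row A) (dim_row C) \<and> symmetric_mat C \<and>
        A' = four_block_mat A B (transpose_mat B) C) \<and>
     mat_rank A = mat_rank A'"

definition normalized_trace :: "real mat \<Rightarrow> real" where
  "normalized_trace A = (\<Sum>i<dim_row A. A $$ (i, i)) / real (dim_row A)"

definition word_eval :: "nat \<Rightarrow> (nat \<Rightarrow> real mat) \<Rightarrow> nat list \<Rightarrow> real mat" where
  "word_eval s A w = foldr (\<lambda>l M. A l * M) w (1\<^sub>m s)"

definition truncated_tracial_moment_sequence :: "nat \<Rightarrow> nat \<Rightarrow> (nat list \<Rightarrow> real) \<Rightarrow> bool" where
  "truncated_tracial_moment_sequence n m y \<longleftrightarrow>
     truncated_tracial_sequence n m y \<and>
     (\<exists>(N::nat) (s::nat) (c :: nat \<Rightarrow> real) (A :: nat \<Rightarrow> nat \<Rightarrow> real mat).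
        1 \<le> N \<and> 1 \<le> s \<and>
        (\<forall>i \<in> {1..N}. 0 \<le> c i) \<and> (\<Sum>i = 1..N. c i) = 1 \<and>
        (\<forall>i \<in> {1..N}. \<forall>l<n. A i l \<in> carrier_mat s s \<and> symmetric_mat (A i l)) \<and>
        (\<forall>w \<in> words n m. y w = (\<Sum>i = 1..N. c i * normalized_trace (word_eval s (A i) w))))"

lemma tracial_moment_matrix_leading_block:
  assumes "symmetric_mat (tracial_moment_matrix n (Suc k) y)"
  shows "symmetric_mat (tracial_moment_matrix n k y) \<and>
    (\<exists>B C. B \<in> carrier_mat (dim_row (tracial_moment_matrix n k y)) (dim_row C) \<and> symmetric_mat C \<and>
      tracial_moment_matrix n (Suc k) y =
        four_block_mat (tracial_moment_matrix n k y) B (transpose_mat B) C)"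
proof -
  define L where "L = length (word_list n k)"
  define R where "R = length (List.n_lists (Suc k) [0..<n])"
  define M where "M = tracial_moment_matrix n (Suc k) y"
  define B where "B = mat L R (\<lambda>(i, j). M $$ (i, L + j))"
  define C where "C = mat R R (\<lambda>(i, j). M $$ (L + i, L + j))"
  have M: "M \<in> carrier_mat (L + R) (L + R)"
    by (simp add: M_def tracial_moment_matrix_def L_def R_def word_list_Suc)
  have sym: "M $$ (i, j) = M $$ (j, i)" if "i < L + R" "j < L + R" for i j
    using assms M that unfolding M_def[symmetric] symmetric_mat_def
    by (metis carrier_matD index_transpose_mat(1))
  have lead: "M $$ (i, j) = tracial_moment_matrix n k y $$ (i, j)" if "i < L" "j < L" for i j
    using that by (simp add: M_def tracial_moment_matrix_def L_def word_list_Suc nth_append)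
  have dims: "dim_row (tracial_moment_matrix n k y) = L" "dim_col (tracial_moment_matrix n k y) = L"
    by (simp_all add: tracial_moment_matrix_def L_def)
  have "symmetric_mat (tracial_moment_matrix n k y)"
    unfolding symmetric_mat_def by (rule eq_matI) (simp_all add: dims lead[symmetric] sym)
  moreover have "symmetric_mat C"
    unfolding symmetric_mat_def by (rule eq_matI) (simp_all add: C_def sym)
  moreover have "M = four_block_mat (tracial_moment_matrix n k y) B (transpose_mat B) C"
    by (rule eq_matI) (use M in \<open>auto simp: dims B_def C_def lead sym\<close>)
  ultimately show ?thesis
    using dims by (intro conjI exI[of _ B] exI[of _ C]) (auto simp: M_def B_def C_def)
qed

end

theory Submission
  imports Defs "Jordan_Normal_Form.Spectral_Radius"
begin

text \<open>Flatness lets the GNS construction close up in finite dimension. Write \<open>M\<^sub>k(y)\<close> as a Gram matrix of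
  vectors \<open>a\<^sub>w\<close> (\<open>deg w \<le> k\<close>); by flatness those with \<open>deg w \<le> k - 1\<close> already span, so there are
  symmetric matrices with \<open>X\<^sub>l a\<^sub>w = a\<^bsub>X\<^sub>l w\<^esub>\<close> and, by the tracial property, symmetric matrices with
  \<open>R\<^sub>l a\<^sub>w = a\<^bsub>w X\<^sub>l\<^esub>\<close> that commute with them. With \<open>e = a\<^sub>1\<close> one gets \<open>y\<^sub>w = \<langle>e, w(X) e\<rangle>\<close>.

  Because \<open>e\<close> is cyclic for the \<open>R\<^sub>l\<close>, the trace of any \<open>Q\<close> commuting with the \<open>R\<^sub>l\<close> has the form
  \<open>tr Q = \<langle>H e, Q e\<rangle>\<close> with a symmetric \<open>H\<close> that commutes with all \<open>X\<^sub>l\<close> and \<open>R\<^sub>l\<close>. On the eigenspace of \<open>H\<close>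
  for \<open>\<lambda>\<close>, with projection \<open>P\<close>, this says \<open>tr (w(X) P) = \<lambda> \<langle>e, w(X) P e\<rangle>\<close>; hence \<open>\<lambda> > 0\<close>, and summing over the
  eigenspaces exhibits \<open>y\<close> as a convex combination of normalized traces. This replaces the
  Wedderburn decomposition of the algebra generated by the \<open>X\<^sub>l\<close>.\<close>

section \<open>The spectral theorem for real symmetric matrices\<close>

text \<open>The complexified matrix has an eigenvector \<open>v\<close> because the field is
  algebraically closed. Moving \<open>C\<close> across the product of \<open>v\<close> with its
  conjugate shows that the eigenvalue equals its own conjugate. The real and imaginary parts of
  \<open>v\<close> then satisfy the same real eigenvalue equation, and a nonzero one of them is
  normalized.\<close>

lemma symmetric_real_eigenvector:
  fixes A :: "real mat"
  assumes A: "A \<in> carrier_mat n n" and sym: "A\<^sup>T = A" and n: "n > 0"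
  obtains v l where "v \<in> carrier_vec n" "v \<bullet> v = 1" "A *\<^sub>v v = l \<cdot>\<^sub>v v"
proof -
  define C where "C = map_mat complex_of_real A"
  have C: "C \<in> carrier_mat n n" using A by (simp add: C_def)
  have CT: "C\<^sup>T = C" using sym A by (intro eq_matI) (auto simp: C_def mat_eq_iff)
  from spectrum_non_empty[OF C n] obtain l v where "eigenvector C v l"
    by (auto simp: spectrum_def eigenvalue_def)
  then have v: "v \<in> carrier_vec n" "v \<noteq> 0\<^sub>v n" and Cv: "C *\<^sub>v v = l \<cdot>\<^sub>v v"
    using C by (auto simp: eigenvector_def)
  have conjC: "C *\<^sub>v conjugate v = conjugate (C *\<^sub>v v)"
    using C v(1) A by (intro eq_vecI) (auto simp: C_def scalar_prod_def)
  have "l * (v \<bullet> conjugate v) = (C *\<^sub>v v) \<bullet> conjugate v"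
    using v by (simp add: Cv)
  also have "\<dots> = v \<bullet> (C *\<^sub>v conjugate v)"
    using transpose_vec_mult_scalar[OF C, of "conjugate v" v] v C CT
    by (metis carrier_vec_conjugate comm_scalar_prod mult_mat_vec_carrier)
  also have "\<dots> = cnj l * (v \<bullet> conjugate v)"
    using v by (simp add: conjC Cv conjugate_smult_vec)
  finally have "l = cnj l"
    using conjugate_square_eq_0_vec[OF v(1)] v(2) by auto
  then have l: "l = complex_of_real (Re l)" by (metis Reals_cnj_iff of_real_Re)
  have Re_part: "A *\<^sub>v map_vec Re v = Re l \<cdot>\<^sub>v map_vec Re v"
    and Im_part: "A *\<^sub>v map_vec Im v = Re l \<cdot>\<^sub>v map_vec Im v"
  proof -
    have *: "(\<Sum>j = 0..<n. complex_of_real (A $$ (i, j)) * v $ j) = complex_of_real (Re l) * v $ i"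
      if "i < n" for i
      using arg_cong[OF Cv, of "\<lambda>x. x $ i"] that A v l by (simp add: C_def scalar_prod_def)
    show "A *\<^sub>v map_vec Re v = Re l \<cdot>\<^sub>v map_vec Re v"
    proof (rule eq_vecI)
      fix i assume "i < dim_vec (Re l \<cdot>\<^sub>v map_vec Re v)"
      then show "(A *\<^sub>v map_vec Re v) $ i = (Re l \<cdot>\<^sub>v map_vec Re v) $ i"
        using arg_cong[OF *[of i], of Re] A v by (simp add: scalar_prod_def)
    qed (use A v in auto)
    show "A *\<^sub>v map_vec Im v = Re l \<cdot>\<^sub>v map_vec Im v"
    proof (rule eq_vecI)
      fix i assume "i < dim_vec (Re l \<cdot>\<^sub>v map_vec Im v)"
      then show "(A *\<^sub>v map_vec Im v) $ i = (Re l \<cdot>\<^sub>v map_vec Im v) $ i"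
        using arg_cong[OF *[of i], of Im] A v by (simp add: scalar_prod_def)
    qed (use A v in auto)
  qed
  have "map_vec Re v \<noteq> 0\<^sub>v n \<or> map_vec Im v \<noteq> 0\<^sub>v n"
  proof (rule ccontr)
    assume "\<not> ?thesis"
    then have "v = 0\<^sub>v n"
      using v(1) by (intro eq_vecI) (auto simp: vec_eq_iff complex_eq_iff)
    with v show False by blast
  qed
  then obtain u where u: "u \<in> carrier_vec n" "u \<noteq> 0\<^sub>v n" "A *\<^sub>v u = Re l \<cdot>\<^sub>v u"
    using Re_part Im_part v(1) by (metis map_carrier_vec)
  have pos: "u \<bullet> u > 0"
    using conjugate_square_greater_0_vec[OF u(1)] u by simp
  define w where "w = (1 / sqrt (u \<bullet> u)) \<cdot>\<^sub>v u"
  have "w \<in> carrier_vec n" using u by (simp add: w_def)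
  moreover have "w \<bullet> w = 1"
    using u pos by (simp add: w_def field_simps)
  moreover have "A *\<^sub>v w = Re l \<cdot>\<^sub>v w"
    using u A by (simp add: w_def mult_mat_vec[of _ n n] smult_smult_assoc mult.commute)
  ultimately show thesis by (rule that)
qed

text \<open>Reflecting in the hyperplane orthogonal to \<open>w = v - unit_vec n 0\<close> exchanges
  the two unit vectors. This supplies a symmetric orthogonal change of basis whose first basis
  vector is \<open>v\<close>.\<close>

lemma householder_reflection:
  fixes v :: "real vec"
  assumes v: "v \<in> carrier_vec n" "v \<bullet> v = 1" and n: "n > 0"
  obtains Q where "Q \<in> carrier_mat n n" "Q\<^sup>T = Q" "Q * Q = 1\<^sub>m n" "Q *\<^sub>v unit_vec n 0 = v"
proof -
  define w where "w i = v $ i - (if i = 0 then 1 else 0)" for i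
  define S where "S = (\<Sum>i=0..<n. w i * w i)"
  \<comment> \<open>If \<open>v\<close> is already the first unit vector, then \<open>S = 0\<close>
    and the convention \<open>2 / 0 = 0\<close> turns \<open>Q\<close> into the identity, which is
    the reflection wanted in that case.\<close>
  define c where "c = 2 / S"
  define Q where "Q = mat n n (\<lambda>(i, j). (if i = j then 1 else 0) - c * w i * w j)"
  have vv: "(\<Sum>i=0..<n. v $ i * v $ i) = 1"
    using v by (simp add: scalar_prod_def)
  \<comment> \<open>Because \<open>v\<close> has norm one, \<open>S\<close> depends only on the
    first entry of \<open>w\<close>. This is the relation that makes the reflected unit vector equal
    to \<open>v\<close>.\<close>
  have "S = (\<Sum>i=0..<n. v $ i * v $ i - 2 * (if i = 0 then v $ i else 0) + (if i = 0 then 1 else 0))"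
    unfolding S_def w_def by (intro sum.cong) (auto simp: algebra_simps)
  also have "\<dots> = 2 - 2 * v $ 0"
    using n vv by (simp add: sum.distrib sum_subtractf sum_distrib_left[symmetric])
  finally have S: "S = - 2 * w 0" by (simp add: w_def)
  have w0: "w i = 0" if "S = 0" "i < n" for i
    using that sum_nonneg_eq_0_iff[of "{0..<n}" "\<lambda>i. w i * w i"] by (auto simp: S_def)
  have Q: "Q \<in> carrier_mat n n" by (simp add: Q_def)
  have "Q\<^sup>T = Q" by (rule eq_matI) (auto simp: Q_def)
  moreover have "Q * Q = 1\<^sub>m n"
  proof (rule eq_matI)
    fix i j assume "i < dim_row (1\<^sub>m n :: real mat)" "j < dim_col (1\<^sub>m n :: real mat)"
    then have i: "i < n" and j: "j < n" by auto
    have "(Q * Q) $$ (i, j) = (\<Sum>l=0..<n. ((if i = l then 1 else 0) - c * w i * w l)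
        * ((if l = j then 1 else 0) - c * w l * w j))"
      using i j by (simp add: Q_def scalar_prod_def)
    also have "\<dots> = (\<Sum>l=0..<n. (if l = i then (if i = j then 1 else 0) else 0)
       - (if l = i then c * w i * w j else 0) - (if l = j then c * w i * w j else 0)
       + c * c * w i * w j * (w l * w l))"
      by (intro sum.cong) (auto simp: algebra_simps)
    also have "\<dots> = (if i = j then 1 else 0) - 2 * c * w i * w j + c * c * w i * w j * S"
      using i j by (simp add: sum.distrib sum_subtractf sum_distrib_left[symmetric] S_def)
    also have "\<dots> = (if i = j then 1 else 0)"
      by (simp add: c_def)
    finally show "(Q * Q) $$ (i, j) = 1\<^sub>m n $$ (i, j)" using i j by simp
  qed (auto simp: Q_def)
  moreover have "Q *\<^sub>v unit_vec n 0 = v"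
  proof (rule eq_vecI)
    fix i assume "i < dim_vec v"
    then have i: "i < n" using v by auto
    have "(Q *\<^sub>v unit_vec n 0) $ i = (if i = 0 then 1 else 0) - c * w i * w 0"
      using i n by (simp add: Q_def)
    also have "\<dots> = (if i = 0 then 1 else 0) + w i"
      using S w0[of i] i by (cases "S = 0") (auto simp: c_def field_simps)
    finally show "(Q *\<^sub>v unit_vec n 0) $ i = v $ i" by (simp add: w_def)
  qed (use v in \<open>auto simp: Q_def\<close>)
  ultimately show thesis using Q that by blast
qed

lemma mult_block_diagonal:
  fixes A B :: "'a :: comm_ring_1 mat"
  assumes "A \<in> carrier_mat p p" "A' \<in> carrier_mat p p" "B \<in> carrier_mat q q" "B' \<in> carrier_mat q q"
  shows "four_block_mat A (0\<^sub>m p q) (0\<^sub>m q p) B * four_block_mat A' (0\<^sub>m p q) (0\<^sub>m q p) B' =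
    four_block_mat (A * A') (0\<^sub>m p q) (0\<^sub>m q p) (B * B')"
proof -
  have "A * A' \<in> carrier_mat p p" "B * B' \<in> carrier_mat q q" using assms by auto
  then show ?thesis
    using assms by (subst mult_four_block_mat[of _ p p _ q _ q _ _ p _ q]) auto
qed

text \<open>Induction on the dimension. Conjugation by a Householder matrix carries a unit
  eigenvector to the first basis vector; symmetry then clears the first row along with the first
  column, and a symmetric block of size one less remains.\<close>

theorem symmetric_real_diagonalization:
  fixes A :: "real mat"
  assumes "A \<in> carrier_mat n n" "A\<^sup>T = A"
  obtains U d where "U \<in> carrier_mat n n" "U\<^sup>T * U = 1\<^sub>m n" "A = U * mat_diag n d * U\<^sup>T"
proof -
  have "\<exists>U d. U \<in> carrier_mat n n \<and> U\<^sup>T * U = 1\<^sub>m n \<and> A = U * mat_diag n d * U\<^sup>T"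
    using assms
  proof (induction n arbitrary: A)
    case 0
    then show ?case by (intro exI[of _ "1\<^sub>m 0"] exI[of _ undefined]) auto
  next
    case (Suc n)
    let ?N = "Suc n"
    obtain v l where v: "v \<in> carrier_vec ?N" "v \<bullet> v = 1" "A *\<^sub>v v = l \<cdot>\<^sub>v v"
      using symmetric_real_eigenvector[OF Suc.prems] by auto
    obtain Q where Q: "Q \<in> carrier_mat ?N ?N" "Q\<^sup>T = Q" "Q * Q = 1\<^sub>m ?N"
        "Q *\<^sub>v unit_vec ?N 0 = v"
      using householder_reflection[OF v(1,2)] by auto
    note A = Suc.prems(1)
    define B where "B = Q * A * Q"
    have B: "B \<in> carrier_mat ?N ?N" using Q A by (simp add: B_def)
    have BT: "B\<^sup>T = B"
      using Q A Suc.prems(2) by (simp add: B_def assoc_mult_mat[of _ ?N ?N _ ?N _ ?N] transpose_mult[of _ ?N ?N _ ?N] mult_carrier_mat[of _ ?N ?N _ ?N])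
    have Qv: "Q *\<^sub>v v = unit_vec ?N 0"
    proof -
      have "Q *\<^sub>v v = Q *\<^sub>v (Q *\<^sub>v unit_vec ?N 0)" by (simp add: Q)
      also have "\<dots> = (Q * Q) *\<^sub>v unit_vec ?N 0"
        using Q(1) by (intro assoc_mult_mat_vec[symmetric]) auto
      finally show ?thesis by (simp add: Q)
    qed
    have "B *\<^sub>v unit_vec ?N 0 = Q *\<^sub>v (A *\<^sub>v v)"
      using Q(1) A v
      by (simp add: B_def assoc_mult_mat_vec[of _ ?N ?N _ ?N] mult_carrier_mat[of _ ?N ?N _ ?N] Q(4))
    also have "\<dots> = l \<cdot>\<^sub>v unit_vec ?N 0"
      using Q(1) v by (simp add: v(3) mult_mat_vec[of _ ?N ?N] Qv)
    finally have col0: "B *\<^sub>v unit_vec ?N 0 = l \<cdot>\<^sub>v unit_vec ?N 0" .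
    have B_col: "B $$ (i, 0) = (if i = 0 then l else 0)" if "i < ?N" for i
      using arg_cong[OF col0, of "\<lambda>x. x $ i"] that B by simp
    have B_sym: "B $$ (i, j) = B $$ (j, i)" if "i < ?N" "j < ?N" for i j
      using that B BT by (metis carrier_matD index_transpose_mat(1))
    define A' where "A' = mat n n (\<lambda>(i, j). B $$ (Suc i, Suc j))"
    have A': "A' \<in> carrier_mat n n" "A'\<^sup>T = A'"
      by (auto simp: A'_def B_sym intro!: eq_matI)
    from Suc.IH[OF this] obtain U' d' where U': "U' \<in> carrier_mat n n" "U'\<^sup>T * U' = 1\<^sub>m n"
        "A' = U' * mat_diag n d' * U'\<^sup>T" by blast
    define d where "d = case_nat l d'"
    define W where "W = four_block_mat (1\<^sub>m 1) (0\<^sub>m 1 n) (0\<^sub>m n 1) U'"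
    have W: "W \<in> carrier_mat ?N ?N" using U' by (auto simp: W_def)
    have WT: "W\<^sup>T = four_block_mat (1\<^sub>m 1) (0\<^sub>m 1 n) (0\<^sub>m n 1) U'\<^sup>T"
      using U' by (simp add: W_def transpose_four_block_mat[of _ 1 1 _ n _ n])
    have one: "four_block_mat (1\<^sub>m 1) (0\<^sub>m 1 n) (0\<^sub>m n 1) (1\<^sub>m n) = (1\<^sub>m ?N :: real mat)"
      by (rule eq_matI) auto
    have diag: "mat_diag ?N d = four_block_mat (l \<cdot>\<^sub>m 1\<^sub>m 1) (0\<^sub>m 1 n) (0\<^sub>m n 1) (mat_diag n d')"
      by (rule eq_matI) (auto simp: mat_diag_def d_def split: nat.splits)
    have B4: "B = four_block_mat (l \<cdot>\<^sub>m 1\<^sub>m 1) (0\<^sub>m 1 n) (0\<^sub>m n 1) A'"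
      using B by (intro eq_matI) (auto simp: A'_def B_col B_sym[of 0])
    have WW: "W\<^sup>T * W = 1\<^sub>m ?N"
      unfolding WT using U' by (simp add: W_def mult_block_diagonal[of _ "Suc 0" _ _ n] one)
    have BW: "B = W * mat_diag ?N d * W\<^sup>T"
      unfolding B4 WT diag U'(3) using U'
      by (simp add: W_def mult_block_diagonal[of _ "Suc 0" _ _ n] mult_carrier_mat[of _ n n _ n]
          )
    have D: "mat_diag ?N d \<in> carrier_mat ?N ?N" by simp
    note carr = Q(1) A W D B
    have *: "Q * (Q * Y) = Y" if "Y \<in> carrier_mat ?N ?N" for Y
      using that Q by (metis assoc_mult_mat left_mult_one_mat)
    have "A = Q * B * Q"
    proof -
      have "Q * B * Q = Q * (Q * (A * (Q * Q)))"
        using carr by (simp add: B_def assoc_mult_mat[of _ ?N ?N _ ?N _ ?N] del: Q(3))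
      also have "\<dots> = A" using A by (simp add: * Q(3))
      finally show ?thesis by simp
    qed
    also have "\<dots> = (Q * W) * mat_diag ?N d * (Q * W)\<^sup>T"
      using carr by (simp add: BW transpose_mult[of _ ?N ?N _ ?N] mult_carrier_mat[of _ ?N ?N _ ?N] Q(2) assoc_mult_mat[of _ ?N ?N _ ?N _ ?N])
    finally have "A = (Q * W) * mat_diag ?N d * (Q * W)\<^sup>T" .
    moreover have "(Q * W)\<^sup>T * (Q * W) = 1\<^sub>m ?N"
      using carr by (simp add: transpose_mult[of _ ?N ?N _ ?N] mult_carrier_mat[of _ ?N ?N _ ?N] Q(2) assoc_mult_mat[of _ ?N ?N _ ?N _ ?N] * WW)
    moreover have "Q * W \<in> carrier_mat ?N ?N" using carr by auto
    ultimately show ?case by blast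
  qed
  then show thesis using that by blast
qed

section \<open>Rank and Gram factorizations\<close>

text \<open>The column space of the product lies in that of \<open>B\<close>, which is spanned by
  \<open>r\<close> columns.\<close>

lemma rank_mult_le:
  fixes B C :: "real mat"
  assumes B: "B \<in> carrier_mat n r" and C: "C \<in> carrier_mat r m"
  shows "vec_space.rank n (B * C) \<le> r"
proof -
  interpret vec_space "TYPE(real)" n .
  have BC: "B * C \<in> carrier_mat n m" using B C by auto
  have sub: "col_space (B * C) \<subseteq> col_space B"
    unfolding col_space_eq[OF BC] col_space_eq[OF B] using B C
    by (auto simp: assoc_mult_mat_vec[of _ n r _ m])
  have colsB: "set (cols B) \<subseteq> carrier_vec n" and colsBC: "set (cols (B * C)) \<subseteq> carrier_vec n"
    using B BC cols_dim by blast+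
  have ss: "VectorSpace.subspace class_ring (span (set (cols B))) V"
    "VectorSpace.subspace class_ring (span (set (cols (B * C)))) V"
    using colsB colsBC by (auto intro!: span_is_subspace)
  have "VectorSpace.subspace class_ring (span (set (cols (B * C)))) (vs (span (set (cols B))))"
    using nested_subspaces[OF ss] sub by (simp add: col_space_def)
  moreover have "vectorspace class_ring (vs (span (set (cols B))))"
    using ss(1) subspace_is_vs by blast
  ultimately have "rank (B * C) \<le> rank B"
    unfolding rank_def
    using vectorspace.subspace_dim[of class_ring "vs (span (set (cols B)))"
        "span (set (cols (B * C)))"] fin_dim_span_cols[OF B] fin_dim_span_cols[OF BC]
    by simp
  then show ?thesis using rank_le_nc[OF B] by simp
qed

text \<open>If \<open>A * Y\<close> has a left inverse, its \<open>r\<close> columns are independent vectors of the column space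
  of \<open>A\<close>, which they exhaust when that space has dimension at most \<open>r\<close>.\<close>

lemma full_rank_factorization:
  fixes A :: "real mat"
  assumes A: "A \<in> carrier_mat n m" and rank: "vec_space.rank n A \<le> r"
    and Y: "Y \<in> carrier_mat m r" and L: "L \<in> carrier_mat r n" and inv: "L * (A * Y) = 1\<^sub>m r"
  obtains Z where "Z \<in> carrier_mat r m" "A = A * Y * Z"
proof -
  interpret vec_space "TYPE(real)" n .
  define C where "C = A * Y"
  have C: "C \<in> carrier_mat n r" using A Y by (simp add: C_def)
  have inj: "v = 0\<^sub>v r" if "v \<in> carrier_vec r" "C *\<^sub>v v = 0\<^sub>v n" for v
  proof -
    have "v = L *\<^sub>v (C *\<^sub>v v)"
      using assoc_mult_mat_vec[OF L C that(1)] inv that(1) by (simp add: C_def)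
    then show ?thesis using that L by (auto intro!: eq_vecI simp: scalar_prod_def)
  qed
  have dist: "distinct (cols C)"
  proof (rule ccontr)
    assume "\<not> ?thesis"
    then obtain i j where ij: "i < r" "j < r" "i \<noteq> j" "col C i = col C j"
      using C by (auto simp: distinct_conv_nth)
    have "unit_vec r i = L *\<^sub>v col C i" "unit_vec r j = L *\<^sub>v col C j"
      using inv L C ij by (metis C_def col_mult2 col_one)+
    then have "unit_vec r i $ i = (unit_vec r j $ i :: real)" using ij by simp
    then show False using ij by simp
  qed
  have indpt: "lin_indpt (set (cols C))"
  proof
    assume "lin_dep (set (cols C))"
    then obtain v where "v \<in> carrier_vec r" "v \<noteq> 0\<^sub>v r" "C *\<^sub>v v = 0\<^sub>v n"
      using lin_depE[OF C _ dist] by blast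
    then show False using inj by blast
  qed
  let ?S = "set (cols C)" and ?W = "span (set (cols A))"
  have AW: "set (cols A) \<subseteq> carrier_vec n" and CW: "?S \<subseteq> carrier_vec n"
    using A C cols_dim by blast+
  have "col_space C \<subseteq> col_space A"
    unfolding C_def using A Y
    by (auto simp: col_space_eq[of _ m] col_space_eq[of _ r] assoc_mult_mat_vec[of _ n m _ r])
  then have sub: "?S \<subseteq> ?W"
    using in_own_span[OF CW] by (auto simp: col_space_def)
  have ss: "VectorSpace.subspace class_ring ?W V" using AW by (auto intro!: span_is_subspace)
  then have vsW: "vectorspace class_ring (vs ?W)" by (rule subspace_is_vs)
  have sm: "submodule class_ring ?W V" using AW by (auto intro!: span_is_submodule)
  have "vectorspace.basis class_ring (vs ?W) ?S"
  proof (rule vectorspace.dim_li_is_basis[OF vsW])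
    show "vectorspace.fin_dim class_ring (vs ?W)" using fin_dim_span_cols[OF A] .
    show "LinearCombinations.module.lin_indpt class_ring (vs ?W) ?S"
      using span_li_not_depend(2)[OF sub sm] indpt by simp
    have "card ?S = r" using distinct_card[OF dist] C by simp
    then show "card ?S \<ge> vectorspace.dim class_ring (vs ?W)"
      using rank by (simp add: rank_def)
  qed (use sub in auto)
  then have "span ?S = ?W"
    using vectorspace.basis_def[OF vsW, of ?S] span_li_not_depend(1)[OF sub sm] by simp
  then have colsp: "col_space A = col_space C" by (simp add: col_space_def)
  have "\<exists>z \<in> carrier_vec r. C *\<^sub>v z = col A j" if "j < m" for j
  proof -
    have "col A j \<in> col_space A"
      unfolding col_space_def using in_own_span[OF AW] that A by (auto simp: cols_def)
    then show ?thesis unfolding colsp col_space_eq[OF C] using C by auto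
  qed
  then obtain z where z: "\<And>j. j < m \<Longrightarrow> z j \<in> carrier_vec r" "\<And>j. j < m \<Longrightarrow> C *\<^sub>v z j = col A j"
    by metis
  define Z where "Z = mat r m (\<lambda>(i, j). z j $ i)"
  have Z: "Z \<in> carrier_mat r m" by (simp add: Z_def)
  have "A = C * Z"
  proof (rule mat_col_eqI)
    fix j assume "j < dim_col (C * Z)"
    then have j: "j < m" by (simp add: Z_def)
    have "col Z j = z j" using z(1)[OF j] j by (auto simp: Z_def)
    then show "col A j = col (C * Z) j" using z(2)[OF j] col_mult2[OF C Z j] by simp
  qed (use A C Z in auto)
  then show thesis using that Z by (simp add: C_def)
qed

text \<open>Variants of library facts whose side conditions mention only dimensions, so that the
  simplifier can discharge them without guessing the inner dimension of a product.\<close>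

lemma assoc_mult_mat_dim:
  "dim_col A = dim_row B \<Longrightarrow> dim_col B = dim_row C \<Longrightarrow> (A * B) * C = A * (B * C)"
  for A B C :: "'a :: semiring_0 mat"
  by (rule assoc_mult_mat[of _ "dim_row A" "dim_row B" _ "dim_row C" _ "dim_col C"]) auto

lemma assoc_mult_mat_vec_dim:
  "dim_col A = dim_row B \<Longrightarrow> dim_col B = dim_vec v \<Longrightarrow> (A * B) *\<^sub>v v = A *\<^sub>v (B *\<^sub>v v)"
  for A B :: "'a :: semiring_0 mat"
  by (rule assoc_mult_mat_vec[of _ "dim_row A" "dim_row B" _ "dim_vec v"]) (auto intro: carrier_vecI)

lemma transpose_mult_dim:
  "dim_col A = dim_row B \<Longrightarrow> (A * B)\<^sup>T = B\<^sup>T * A\<^sup>T"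
  for A B :: "'a :: comm_semiring_0 mat"
  by (rule transpose_mult[of _ "dim_row A" "dim_row B" _ "dim_col B"]) auto

lemma scalar_prod_mult_mat_vec_dim:
  "dim_vec y = dim_row A \<Longrightarrow> dim_vec x = dim_col A \<Longrightarrow> y \<bullet> (A *\<^sub>v x) = (A\<^sup>T *\<^sub>v y) \<bullet> x"
  for A :: "'a :: comm_semiring_0 mat"
  by (rule transpose_vec_mult_scalar[of _ "dim_row A" "dim_col A", symmetric]) (auto intro: carrier_vecI)

lemma dim_mat_diag [simp]: "dim_row (mat_diag n f) = n" "dim_col (mat_diag n f) = n"
  by (simp_all add: mat_diag_def)

lemmas mat_dim_simps = assoc_mult_mat_dim assoc_mult_mat_vec_dim transpose_mult_dim

text \<open>These are the columns of \<open>mat_diag n f\<close> whose index satisfies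
  \<open>p\<close>. Dropping the other columns makes the matrix rectangular, so that zero
  eigenvalues can be discarded or a single eigenspace picked out.\<close>

definition selection_mat :: "nat \<Rightarrow> (nat \<Rightarrow> bool) \<Rightarrow> (nat \<Rightarrow> real) \<Rightarrow> real mat" where
  "selection_mat n p f =
     mat n (length (filter p [0..<n])) (\<lambda>(i, a). if i = filter p [0..<n] ! a then f i else 0)"

lemma dim_selection_mat [simp]:
  "dim_row (selection_mat n p f) = n" "dim_col (selection_mat n p f) = length (filter p [0..<n])"
  by (simp_all add: selection_mat_def)

lemma mat_diag_mult_selection_mat:
  "mat_diag n g * selection_mat n p f = selection_mat n p (\<lambda>i. g i * f i)"
  by (subst mat_diag_mult_left[of _ n "length (filter p [0..<n])"])
    (auto simp: selection_mat_def intro!: eq_matI)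

lemma selection_mat_transpose_mult:
  assumes "\<And>i. i < n \<Longrightarrow> p i \<Longrightarrow> f i * g i = 1"
  shows "(selection_mat n p f)\<^sup>T * selection_mat n p g = 1\<^sub>m (length (filter p [0..<n]))"
    (is "?A = 1\<^sub>m ?r")
proof (rule eq_matI)
  define nz where "nz = filter p [0..<n]"
  fix a b assume "a < dim_row (1\<^sub>m ?r :: real mat)" "b < dim_col (1\<^sub>m ?r :: real mat)"
  then have ab: "a < length nz" "b < length nz" by (auto simp: nz_def)
  have nz: "nz ! a < n" "p (nz ! a)" using nth_mem[OF ab(1)] by (auto simp: nz_def)
  have inj: "nz ! a = nz ! b \<longleftrightarrow> a = b"
    using ab by (intro nth_eq_iff_index_eq) (auto simp: nz_def)
  have "?A $$ (a, b) =
      (\<Sum>i=0..<n. (if i = nz ! a then f i else 0) * (if i = nz ! b then g i else 0))"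
    using ab by (simp add: selection_mat_def scalar_prod_def nz_def)
  also have "\<dots> = (\<Sum>i=0..<n. if i = nz ! a then (if a = b then 1 else 0) else 0)"
    using assms nz inj by (intro sum.cong) auto
  also have "\<dots> = 1\<^sub>m ?r $$ (a, b)" using ab nz by (simp add: nz_def)
  finally show "?A $$ (a, b) = 1\<^sub>m ?r $$ (a, b)" .
qed auto

text \<open>Each index occurs at most once in the filtered list, so at most one term of each entry
  survives. With \<open>f = g = 1\<close> the result is a coordinate projection; with square roots
  it factors a nonnegative diagonal matrix.\<close>

lemma selection_mat_mult_transpose:
  "selection_mat n p f * (selection_mat n p g)\<^sup>T = mat_diag n (\<lambda>i. if p i then f i * g i else 0)"
    (is "?A = ?B")
proof (rule eq_matI)
  define nz where "nz = filter p [0..<n]"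
  fix i j assume "i < dim_row ?B" "j < dim_col ?B"
  then have ij: "i < n" "j < n" by (auto simp: mat_diag_def)
  have "?A $$ (i, j) = (\<Sum>a=0..<length nz.
      (if i = nz ! a then f i else 0) * (if j = nz ! a then g j else 0))" (is "_ = sum ?h _")
    using ij by (simp add: selection_mat_def scalar_prod_def nz_def)
  also have "\<dots> = (if i = j \<and> p i then f i * g i else 0)"
  proof (cases "i = j \<and> p i")
    case True
    then have "i \<in> set nz" using ij by (auto simp: nz_def)
    then obtain a where a: "a < length nz" "nz ! a = i" by (metis in_set_conv_nth)
    have "distinct nz" by (simp add: nz_def)
    then have "sum ?h {0..<length nz} = (\<Sum>b=0..<length nz. if b = a then f i * g i else 0)"
      using a True by (intro sum.cong) (auto simp: nth_eq_iff_index_eq)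
    then show ?thesis using a True by auto
  next
    case False
    have "p (nz ! a)" if "a < length nz" for a using nth_mem[OF that] by (auto simp: nz_def)
    then have "sum ?h {0..<length nz} = 0"
      using False by (intro sum.neutral) auto
    then show ?thesis using False by auto
  qed
  finally show "?A $$ (i, j) = ?B $$ (i, j)" using ij by (simp add: mat_diag_def)
qed (auto simp: mat_diag_def)

text \<open>Rescaled eigenvectors of the compression \<open>P\<^sup>T * M * P\<close> for its
  nonzero eigenvalues give \<open>Y = P * D\<close> with \<open>Y\<^sup>T * M * Y = 1\<close>. The
  rank hypothesis forces the columns of \<open>M * Y\<close> to span those of \<open>M\<close>, so
  \<open>M = M * Y * Z\<close>, and multiplying by \<open>Y\<^sup>T\<close> identifies
  \<open>Z\<close> as \<open>Y\<^sup>T * M\<close>. Hence \<open>G = Y\<^sup>T * M\<close> is a Gram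
  factor, and \<open>G * P * D = 1\<close> says that the columns of \<open>G * P\<close> alone span
  the whole space.\<close>

lemma flat_gram_factorization:
  fixes M P :: "real mat"
  assumes M: "M \<in> carrier_mat N N" "M\<^sup>T = M"
    and psd: "\<And>v. v \<in> carrier_vec N \<Longrightarrow> 0 \<le> v \<bullet> (M *\<^sub>v v)"
    and P: "P \<in> carrier_mat N N0"
    and rank: "vec_space.rank N M \<le> vec_space.rank N0 (P\<^sup>T * M * P)"
  obtains r G D where "G \<in> carrier_mat r N" "D \<in> carrier_mat N0 r" "G\<^sup>T * G = M" "G * P * D = 1\<^sub>m r"
proof -
  define M0 where "M0 = P\<^sup>T * M * P"
  have dims: "dim_row M = N" "dim_col M = N" "dim_row P = N" "dim_col P = N0"
    using M P by auto
  have M0: "M0 \<in> carrier_mat N0 N0" "M0\<^sup>T = M0"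
    using dims M(2) by (auto simp: M0_def mat_dim_simps)
  obtain U d where U: "U \<in> carrier_mat N0 N0" "U\<^sup>T * U = 1\<^sub>m N0" "M0 = U * mat_diag N0 d * U\<^sup>T"
    using symmetric_real_diagonalization[OF M0] .
  have dimU: "dim_row U = N0" "dim_col U = N0" using U by auto
  have dimd: "dim_row (mat_diag N0 d) = N0" "dim_col (mat_diag N0 d) = N0"
    by (simp_all add: mat_diag_def)
  have cancel: "U\<^sup>T * (U * Y) = Y" if "dim_row Y = N0" for Y
    using U(2) that dimU by (metis assoc_mult_mat_dim index_transpose_mat(3) left_mult_one_mat')
  have UMU: "U\<^sup>T * (M0 * U) = mat_diag N0 d"
    unfolding U(3) using U(2) dimU dimd by (simp add: mat_dim_simps cancel)
  \<comment> \<open>Each eigenvalue of the compression is a value of the quadratic form of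
    \<open>M\<close>, taken at a column of \<open>P * U\<close>.\<close>
  have d: "d i \<ge> 0" if "i < N0" for i
  proof -
    define W where "W = P * U"
    have W: "W \<in> carrier_mat N N0" using P U by (simp add: W_def)
    have "W\<^sup>T * (M * W) = mat_diag N0 d"
      unfolding UMU[symmetric] using dims dimU by (simp add: W_def M0_def mat_dim_simps)
    then have "d i = (W\<^sup>T * (M * W)) $$ (i, i)" using that by (simp add: mat_diag_def)
    also have "\<dots> = col W i \<bullet> (M *\<^sub>v col W i)"
      using that W M by (simp add: col_mult2[of _ N N _ N0] del: col_mult)
    finally show ?thesis using psd[of "col W i"] W that by auto
  qed
  define p where "p i \<longleftrightarrow> d i \<noteq> 0" for i
  define r where "r = length (filter p [0..<N0])"
  \<comment> \<open>On the nonzero eigenvalues, \<open>F\<close> is a square root of the diagonal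
    matrix and \<open>E\<close> is the inverse of that square root.\<close>
  define E where "E = selection_mat N0 p (\<lambda>i. 1 / sqrt (d i))"
  define F where "F = selection_mat N0 p (\<lambda>i. sqrt (d i))"
  have dimE: "dim_row E = N0" "dim_col E = r" "dim_row F = N0" "dim_col F = r"
    by (simp_all add: E_def F_def r_def)
  have EE: "E\<^sup>T * (mat_diag N0 d * E) = 1\<^sub>m r"
    using d unfolding E_def r_def mat_diag_mult_selection_mat
    by (intro selection_mat_transpose_mult) (auto simp: p_def)
  have "mat_diag N0 (\<lambda>i. if p i then sqrt (d i) * sqrt (d i) else 0) = mat_diag N0 d"
    using d by (intro eq_matI) (auto simp: mat_diag_def p_def)
  then have FF: "F * F\<^sup>T = mat_diag N0 d"
    by (simp add: F_def selection_mat_mult_transpose)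
  \<comment> \<open>Factoring the compression through dimension \<open>r\<close> bounds its rank by
    \<open>r\<close>; the rank hypothesis passes this bound on to \<open>M\<close>.\<close>
  have "M0 = (U * F) * (F\<^sup>T * U\<^sup>T)"
    using dimU dimE by (simp add: U(3) FF[symmetric] mat_dim_simps)
  moreover have "vec_space.rank N0 ((U * F) * (F\<^sup>T * U\<^sup>T)) \<le> r"
    using U dimE by (intro rank_mult_le[of _ _ _ _ N0]) auto
  ultimately have rankM: "vec_space.rank N M \<le> r" using rank by (simp add: M0_def)
  define D where "D = U * E"
  define Y where "Y = P * D"
  have dimD: "dim_row D = N0" "dim_col D = r" "dim_row Y = N" "dim_col Y = r"
    using dimU dims dimE by (simp_all add: D_def Y_def)
  have inv: "Y\<^sup>T * (M * Y) = 1\<^sub>m r"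
  proof -
    have "Y\<^sup>T * (M * Y) = E\<^sup>T * ((U\<^sup>T * (M0 * U)) * E)"
      using dimU dims dimE by (simp add: Y_def D_def M0_def mat_dim_simps)
    then show ?thesis by (simp add: UMU EE)
  qed
  obtain Z where Z: "Z \<in> carrier_mat r N" "M = M * Y * Z"
    by (rule full_rank_factorization[OF M(1) rankM _ _ inv]) (auto simp: dimD)
  have ZM: "Y\<^sup>T * M = Z"
  proof -
    have "Y\<^sup>T * M = Y\<^sup>T * (M * Y * Z)" by (simp flip: Z(2))
    also have "\<dots> = (Y\<^sup>T * (M * Y)) * Z" using Z(1) dims dimD by (simp add: mat_dim_simps)
    finally show ?thesis using Z(1) by (simp add: inv)
  qed
  show thesis
  proof (rule that)
    show "Y\<^sup>T * M \<in> carrier_mat r N" "D \<in> carrier_mat N0 r" using dimD dims by auto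
    have "(Y\<^sup>T * M)\<^sup>T * (Y\<^sup>T * M) = M * Y * Z"
      using dims dimD M(2) Z(1) by (simp add: ZM[symmetric] mat_dim_simps)
    then show "(Y\<^sup>T * M)\<^sup>T * (Y\<^sup>T * M) = M" by (simp flip: Z(2))
    have "Y\<^sup>T * M * P * D = Y\<^sup>T * (M * Y)"
      using dims dimD by (simp add: Y_def mat_dim_simps)
    then show "Y\<^sup>T * M * P * D = 1\<^sub>m r" by (simp add: inv)
  qed
qed

section \<open>Traces and words\<close>

definition mat_trace :: "real mat \<Rightarrow> real" where
  "mat_trace A = (\<Sum>i<dim_row A. A $$ (i, i))"

lemma mat_trace_transpose: "A \<in> carrier_mat m m \<Longrightarrow> mat_trace A\<^sup>T = mat_trace A"
  by (auto simp: mat_trace_def intro!: sum.cong)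

lemma mat_trace_mult_comm:
  assumes "A \<in> carrier_mat p q" "B \<in> carrier_mat q p"
  shows "mat_trace (A * B) = mat_trace (B * A)"
proof -
  have "mat_trace (A * B) = (\<Sum>i<p. \<Sum>j<q. A $$ (i, j) * B $$ (j, i))"
    using assms by (simp add: mat_trace_def scalar_prod_def atLeast0LessThan)
  also have "\<dots> = (\<Sum>j<q. \<Sum>i<p. A $$ (i, j) * B $$ (j, i))" by (rule sum.swap)
  also have "\<dots> = mat_trace (B * A)"
    using assms by (simp add: mat_trace_def scalar_prod_def atLeast0LessThan mult.commute)
  finally show ?thesis .
qed

lemma word_eval_Nil [simp]: "word_eval m A [] = 1\<^sub>m m"
  by (simp add: word_eval_def)

lemma word_eval_Cons [simp]: "word_eval m A (l # w) = A l * word_eval m A w"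
  by (simp add: word_eval_def)

lemma word_eval_carrier:
  assumes "\<And>l. l < n \<Longrightarrow> A l \<in> carrier_mat m m" "set w \<subseteq> {..<n}"
  shows "word_eval m A w \<in> carrier_mat m m"
  using assms(2) by (induction w) (auto intro: mult_carrier_mat assms(1))

lemma word_eval_append:
  assumes A: "\<And>l. l < n \<Longrightarrow> A l \<in> carrier_mat m m" and "set u \<subseteq> {..<n}" "set v \<subseteq> {..<n}"
  shows "word_eval m A (u @ v) = word_eval m A u * word_eval m A v"
  using assms(2)
proof (induction u)
  case Nil
  then show ?case using word_eval_carrier[of n A m, OF A assms(3)] by simp
next
  case (Cons l u)
  then have "word_eval m A u \<in> carrier_mat m m" "A l \<in> carrier_mat m m"
    by (auto intro: word_eval_carrier A)
  then show ?case
    using Cons word_eval_carrier[of n A m, OF A assms(3)]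
    by (simp add: assoc_mult_mat[of _ m m _ m _ m])
qed

lemma word_eval_transpose:
  assumes A: "\<And>l. l < n \<Longrightarrow> A l \<in> carrier_mat m m" and sym: "\<And>l. l < n \<Longrightarrow> (A l)\<^sup>T = A l"
    and "set w \<subseteq> {..<n}"
  shows "(word_eval m A w)\<^sup>T = word_eval m A (rev w)"
  using assms(3)
proof (induction w)
  case (Cons l w)
  then have "word_eval m A w \<in> carrier_mat m m" "A l \<in> carrier_mat m m"
    by (auto intro: word_eval_carrier A)
  then show ?case
    using Cons by (simp add: transpose_mult[of _ m m _ m] sym word_eval_append[of n A m, OF A])
qed simp

lemma word_eval_commute:
  assumes A: "\<And>l. l < n \<Longrightarrow> A l \<in> carrier_mat m m" and Q: "Q \<in> carrier_mat m m"
    and comm: "\<And>l. l < n \<Longrightarrow> Q * A l = A l * Q" and "set w \<subseteq> {..<n}"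
  shows "Q * word_eval m A w = word_eval m A w * Q"
  using assms(4)
proof (induction w)
  case (Cons l w)
  then have W: "word_eval m A w \<in> carrier_mat m m" "A l \<in> carrier_mat m m"
    by (auto intro: word_eval_carrier A)
  have "Q * word_eval m A (l # w) = (Q * A l) * word_eval m A w"
    using W Q by (simp add: assoc_mult_mat[of _ m m _ m _ m])
  also have "\<dots> = A l * (Q * word_eval m A w)"
    using W Q Cons comm[of l] by (simp add: assoc_mult_mat[of _ m m _ m _ m])
  also have "\<dots> = word_eval m A (l # w) * Q"
    using W Q Cons by (simp add: assoc_mult_mat[of _ m m _ m _ m])
  finally show ?case .
qed (use Q in simp)

section \<open>Tracial representations\<close>

text \<open>The right inverse \<open>D\<close> is a computational way to say that the columns of
  \<open>G\<close> span: vectors and operators are determined by their products with these columns,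
  and \<open>D\<close> turns prescribed images of the columns into a matrix.\<close>

locale spanning_columns =
  fixes r m :: nat and G D :: "real mat"
  assumes G: "G \<in> carrier_mat r m" and D: "D \<in> carrier_mat m r" and GD: "G * D = 1\<^sub>m r"
begin

lemma dims: "dim_row G = r" "dim_col G = m" "dim_row D = m" "dim_col D = r"
  using G D by auto

lemma DG_transpose: "D\<^sup>T * G\<^sup>T = 1\<^sub>m r"
  using GD dims by (metis transpose_mult_dim transpose_one)

lemma vec_eqI:
  assumes "x \<in> carrier_vec r" "y \<in> carrier_vec r" "\<And>j. j < m \<Longrightarrow> col G j \<bullet> x = col G j \<bullet> y"
  shows "x = y"
proof -
  have "G\<^sup>T *\<^sub>v x = G\<^sup>T *\<^sub>v y" using assms dims by (intro eq_vecI) auto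
  then have "(D\<^sup>T * G\<^sup>T) *\<^sub>v x = (D\<^sup>T * G\<^sup>T) *\<^sub>v y"
    using assms dims by (simp add: assoc_mult_mat_vec_dim)
  then show ?thesis using assms by (simp add: DG_transpose)
qed

lemma mat_eqI:
  assumes S: "S \<in> carrier_mat r r" and T: "T \<in> carrier_mat r r"
    and eq: "\<And>i j. i < m \<Longrightarrow> j < m \<Longrightarrow> col G i \<bullet> (S *\<^sub>v col G j) = col G i \<bullet> (T *\<^sub>v col G j)"
  shows "S = T"
proof -
  have "S *\<^sub>v col G j = T *\<^sub>v col G j" if "j < m" for j
    using that S T G by (intro vec_eqI) (auto simp: eq intro: mult_mat_vec_carrier)
  then have "S * G = T * G"
    using S T G by (intro mat_col_eqI) (auto simp: col_mult2[of _ r r _ m] simp del: col_mult)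
  then have "S * (G * D) = T * (G * D)"
    using S T dims by (metis assoc_mult_mat_dim carrier_matD(2))
  then show ?thesis using S T by (simp add: GD)
qed

text \<open>The symmetry condition already makes the assignment well defined: a linear relation
  among the columns of \<open>G\<close> yields a combination of the \<open>c j\<close> that is
  orthogonal to every column, hence zero. In matrix form,
  \<open>G\<^sup>T * H = H\<^sup>T * G\<close> together with
  \<open>D\<^sup>T * G\<^sup>T = 1\<close> makes \<open>H * D\<close> symmetric and gives
  \<open>H * D * G = H\<close>. The multiplication operators and the density are all built this
  way.\<close>

lemma symmetric_extension:
  assumes c: "\<And>j. j < m \<Longrightarrow> c j \<in> carrier_vec r"
    and sym: "\<And>i j. i < m \<Longrightarrow> j < m \<Longrightarrow> col G i \<bullet> c j = c i \<bullet> col G j"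
  obtains X where "X \<in> carrier_mat r r" "X\<^sup>T = X" "\<And>j. j < m \<Longrightarrow> X *\<^sub>v col G j = c j"
proof -
  define H where "H = mat r m (\<lambda>(i, j). c j $ i)"
  have H: "H \<in> carrier_mat r m" by (simp add: H_def)
  then have dimH: "dim_row H = r" "dim_col H = m" by auto
  have col_H: "col H j = c j" if "j < m" for j
    using that c[OF that] by (auto simp: H_def)
  have GH: "G\<^sup>T * H = H\<^sup>T * G"
  proof (rule eq_matI)
    fix i j assume "i < dim_row (H\<^sup>T * G)" "j < dim_col (H\<^sup>T * G)"
    then have "i < m" "j < m" using dims dimH by auto
    then show "(G\<^sup>T * H) $$ (i, j) = (H\<^sup>T * G) $$ (i, j)"
      using dims dimH sym by (simp add: col_H)
  qed (use dims dimH in auto)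
  define X where "X = H * D"
  have X: "X \<in> carrier_mat r r" using H D by (simp add: X_def)
  have XT: "X\<^sup>T = X"
  proof -
    have "X\<^sup>T = D\<^sup>T * (H\<^sup>T * (G * D))" using dims dimH by (simp add: X_def transpose_mult_dim GD)
    also have "\<dots> = D\<^sup>T * ((G\<^sup>T * H) * D)" using dims dimH by (simp add: GH assoc_mult_mat_dim)
    also have "\<dots> = (D\<^sup>T * G\<^sup>T) * (H * D)" using dims dimH by (simp add: assoc_mult_mat_dim)
    finally have "X\<^sup>T = 1\<^sub>m r * X" by (simp add: DG_transpose X_def)
    then show ?thesis by (simp add: left_mult_one_mat[OF X])
  qed
  have "X * G = H"
  proof -
    have "X * G = X\<^sup>T * G" by (simp add: XT)
    also have "\<dots> = D\<^sup>T * (H\<^sup>T * G)" using dims dimH by (simp add: X_def mat_dim_simps)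
    also have "\<dots> = (D\<^sup>T * G\<^sup>T) * H" using dims dimH by (simp add: GH[symmetric] assoc_mult_mat_dim)
    finally show ?thesis using H by (simp add: DG_transpose)
  qed
  then have "X *\<^sub>v col G j = c j" if "j < m" for j
    using col_mult2[OF X G that] col_H[OF that] by simp
  then show thesis using that X XT by blast
qed

end

text \<open>The matrices \<open>X l\<close> and \<open>R l\<close> model left and right
  multiplication by a letter, and \<open>e\<close> models the empty word. \<open>Xe\<close> reflects
  that a letter multiplies the empty word equally from both sides.\<close>

locale tracial_representation = spanning_columns +
  fixes n :: nat and X R :: "nat \<Rightarrow> real mat" and e :: "real vec" and ws :: "nat list list"
  assumes X: "\<And>l. l < n \<Longrightarrow> X l \<in> carrier_mat r r" "\<And>l. l < n \<Longrightarrow> (X l)\<^sup>T = X l"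
    and R: "\<And>l. l < n \<Longrightarrow> R l \<in> carrier_mat r r" "\<And>l. l < n \<Longrightarrow> (R l)\<^sup>T = R l"
    and XR: "\<And>l i. l < n \<Longrightarrow> i < n \<Longrightarrow> X l * R i = R i * X l"
    and e: "e \<in> carrier_vec r"
    and Xe: "\<And>l. l < n \<Longrightarrow> X l *\<^sub>v e = R l *\<^sub>v e"
    and ws: "\<And>j. j < m \<Longrightarrow> set (ws ! j) \<subseteq> {..<n}"
    and col_G: "\<And>j. j < m \<Longrightarrow> col G j = word_eval r X (ws ! j) *\<^sub>v e"
    and Nil_in_ws: "\<exists>j<m. ws ! j = []"
begin

abbreviation left :: "nat list \<Rightarrow> real mat" where "left \<equiv> word_eval r X"
abbreviation right :: "nat list \<Rightarrow> real mat" where "right \<equiv> word_eval r R"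

lemma left_carrier: "set w \<subseteq> {..<n} \<Longrightarrow> left w \<in> carrier_mat r r"
  by (rule word_eval_carrier[OF X(1)])

lemma right_carrier: "set w \<subseteq> {..<n} \<Longrightarrow> right w \<in> carrier_mat r r"
  by (rule word_eval_carrier[OF R(1)])

lemma left_transpose: "set w \<subseteq> {..<n} \<Longrightarrow> (left w)\<^sup>T = left (rev w)"
  by (rule word_eval_transpose[OF X])

lemma right_transpose: "set w \<subseteq> {..<n} \<Longrightarrow> (right w)\<^sup>T = right (rev w)"
  by (rule word_eval_transpose[OF R])

lemma left_append: "set u \<subseteq> {..<n} \<Longrightarrow> set v \<subseteq> {..<n} \<Longrightarrow> left (u @ v) = left u * left v"
  by (rule word_eval_append[OF X(1)])

lemma right_append: "set u \<subseteq> {..<n} \<Longrightarrow> set v \<subseteq> {..<n} \<Longrightarrow> right (u @ v) = right u * right v"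
  by (rule word_eval_append[OF R(1)])

lemma left_R_commute: "i < n \<Longrightarrow> set w \<subseteq> {..<n} \<Longrightarrow> left w * R i = R i * left w"
  using word_eval_commute[of n X r "R i", OF X(1) R(1)] XR by simp

text \<open>Right multiplications apply the letters in the opposite order, hence the reversal. The
  innermost \<open>R l\<close> acts on \<open>e\<close>, where it may be replaced by
  \<open>X l\<close>, which then commutes out past all remaining right multiplications.\<close>

lemma right_rev_e: "set w \<subseteq> {..<n} \<Longrightarrow> right (rev w) *\<^sub>v e = left w *\<^sub>v e"
proof (induction w)
  case (Cons l w)
  then have l: "l < n" and w: "set w \<subseteq> {..<n}" by auto
  have c: "X l \<in> carrier_mat r r" "R l \<in> carrier_mat r r" "right (rev w) \<in> carrier_mat r r"
      "left w \<in> carrier_mat r r"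
    using X R l w by (simp_all add: right_carrier left_carrier)
  have comm: "X l * right (rev w) = right (rev w) * X l"
    using word_eval_commute[of n R r "X l" "rev w", OF R(1) X(1)] XR l w by simp
  have "right (rev (l # w)) *\<^sub>v e = right (rev w) *\<^sub>v (R l *\<^sub>v e)"
    using right_append[of "rev w" "[l]"] l w c e by (simp add: assoc_mult_mat_vec[of _ r r _ r])
  also have "\<dots> = (right (rev w) * X l) *\<^sub>v e"
    using c e by (simp add: assoc_mult_mat_vec[of _ r r _ r] Xe l)
  also have "\<dots> = X l *\<^sub>v (right (rev w) *\<^sub>v e)"
    unfolding comm[symmetric] using c e by (simp add: assoc_mult_mat_vec[of _ r r _ r])
  also have "\<dots> = left (l # w) *\<^sub>v e"
    using Cons w c e by (simp add: assoc_mult_mat_vec[of _ r r _ r])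
  finally show ?case .
qed simp

text \<open>Since \<open>col G u = R\<^sub>u\<^sup>* e\<close>, expanding \<open>tr Q = tr (D Q G)\<close> over the words moves every \<open>R\<^sub>u\<^sup>*\<close> past \<open>Q\<close>.\<close>

lemma trace_commutant:
  obtains z where "z \<in> carrier_vec r"
    "\<And>Q. Q \<in> carrier_mat r r \<Longrightarrow> (\<And>l. l < n \<Longrightarrow> Q * R l = R l * Q) \<Longrightarrow>
       mat_trace Q = z \<bullet> (Q *\<^sub>v e)"
proof -
  \<comment> \<open>Since \<open>right (ws ! u)\<close> is the transpose of
    \<open>right (rev (ws ! u))\<close>, which produces \<open>col G u\<close> from
    \<open>e\<close>, this vector collects the rows of \<open>D\<close> after the words have been
    moved to the other side of the scalar product.\<close>
  define z where "z = vec r (\<lambda>i. \<Sum>u<m. (right (ws ! u) *\<^sub>v row D u) $ i)"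
  have z: "z \<in> carrier_vec r" by (simp add: z_def)
  moreover have "mat_trace Q = z \<bullet> (Q *\<^sub>v e)"
    if Q: "Q \<in> carrier_mat r r" and comm: "\<And>l. l < n \<Longrightarrow> Q * R l = R l * Q" for Q
  proof -
    have "mat_trace Q = mat_trace (Q * (G * D))" using Q by (simp add: GD)
    also have "\<dots> = mat_trace ((Q * G) * D)" using Q dims by (simp add: assoc_mult_mat_dim)
    also have "\<dots> = mat_trace (D * (Q * G))"
      using Q G D by (intro mat_trace_mult_comm[of _ r m]) auto
    also have "\<dots> = (\<Sum>u<m. row D u \<bullet> (Q *\<^sub>v col G u))"
      using Q G D by (simp add: mat_trace_def col_mult2[of _ r r _ m] del: col_mult)
    also have "\<dots> = (\<Sum>u<m. (right (ws ! u) *\<^sub>v row D u) \<bullet> (Q *\<^sub>v e))"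
    proof (rule sum.cong)
      fix u assume "u \<in> {..<m}"
      then have u: "u < m" by simp
      have c: "right (rev (ws ! u)) \<in> carrier_mat r r" "right (ws ! u) \<in> carrier_mat r r"
        using ws[OF u] by (simp_all add: right_carrier)
      have "Q *\<^sub>v col G u = (Q * right (rev (ws ! u))) *\<^sub>v e"
        using col_G[OF u] right_rev_e[OF ws[OF u]] Q c e by (simp add: assoc_mult_mat_vec[of _ r r _ r])
      also have "\<dots> = right (rev (ws ! u)) *\<^sub>v (Q *\<^sub>v e)"
        using word_eval_commute[of n R r Q "rev (ws ! u)", OF R(1) Q comm] ws[OF u] c Q e
        by (simp add: assoc_mult_mat_vec[of _ r r _ r])
      finally have *: "Q *\<^sub>v col G u = right (rev (ws ! u)) *\<^sub>v (Q *\<^sub>v e)" .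
      show "row D u \<bullet> (Q *\<^sub>v col G u) = (right (ws ! u) *\<^sub>v row D u) \<bullet> (Q *\<^sub>v e)"
        unfolding * using c Q e D u right_transpose[of "rev (ws ! u)"] ws[OF u]
        by (subst scalar_prod_mult_mat_vec_dim) auto
    qed simp
    also have "\<dots> = (\<Sum>u<m. \<Sum>i<r. (right (ws ! u) *\<^sub>v row D u) $ i * (Q *\<^sub>v e) $ i)"
      using Q e by (simp add: scalar_prod_def atLeast0LessThan)
    also have "\<dots> = (\<Sum>i<r. \<Sum>u<m. (right (ws ! u) *\<^sub>v row D u) $ i * (Q *\<^sub>v e) $ i)"
      by (rule sum.swap)
    also have "\<dots> = z \<bullet> (Q *\<^sub>v e)"
      using Q e by (simp add: z_def scalar_prod_def atLeast0LessThan sum_distrib_right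
        del: index_mult_mat_vec)
    finally show ?thesis .
  qed
  ultimately show thesis using that by blast
qed

text \<open>The vector \<open>z\<close> represents the trace on the commutant of the
  \<open>R l\<close>, which contains all \<open>left w\<close>. The operator sending
  \<open>left w *\<^sub>v e\<close> to \<open>left w *\<^sub>v z\<close> is symmetric and commutes
  with the \<open>X l\<close> because a trace is invariant under transposition, which reverses
  words; for the \<open>R l\<close> cyclicity of the trace enters as well.\<close>

lemma central_density:
  "\<exists>H. H \<in> carrier_mat r r \<and> H\<^sup>T = H \<and> (\<forall>l<n. H * X l = X l * H) \<and> (\<forall>l<n. H * R l = R l * H) \<and>
    (\<forall>Q \<in> carrier_mat r r. (\<forall>l<n. Q * R l = R l * Q) \<longrightarrow> mat_trace Q = (H *\<^sub>v e) \<bullet> (Q *\<^sub>v e))"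
proof -
  obtain z where z: "z \<in> carrier_vec r"
    and tr: "\<And>Q. Q \<in> carrier_mat r r \<Longrightarrow> (\<And>l. l < n \<Longrightarrow> Q * R l = R l * Q) \<Longrightarrow>
       mat_trace Q = z \<bullet> (Q *\<^sub>v e)"
    using trace_commutant by blast
  have tr_left: "(left u *\<^sub>v z) \<bullet> (left v *\<^sub>v e) = mat_trace (left (rev u @ v))"
    if uv: "set u \<subseteq> {..<n}" "set v \<subseteq> {..<n}" for u v
  proof -
    have c: "left u \<in> carrier_mat r r" "left v \<in> carrier_mat r r" "left (rev u) \<in> carrier_mat r r"
      using uv by (simp_all add: left_carrier)
    have "mat_trace (left (rev u @ v)) = z \<bullet> (left (rev u @ v) *\<^sub>v e)"
      using uv by (intro tr left_carrier left_R_commute) auto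
    also have "\<dots> = z \<bullet> (left (rev u) *\<^sub>v (left v *\<^sub>v e))"
      using uv c e by (simp add: left_append assoc_mult_mat_vec[of _ r r _ r])
    also have "\<dots> = (left u *\<^sub>v z) \<bullet> (left v *\<^sub>v e)"
      using uv c e z left_transpose[of "rev u"] by (subst scalar_prod_mult_mat_vec_dim) auto
    finally show ?thesis by simp
  qed
  have tr_rev: "mat_trace (left (rev w)) = mat_trace (left w)" if "set w \<subseteq> {..<n}" for w
    using that by (metis left_carrier left_transpose mat_trace_transpose)
  have tr_rot: "mat_trace (left (u @ v)) = mat_trace (left (v @ u))"
    if "set u \<subseteq> {..<n}" "set v \<subseteq> {..<n}" for u v
    using that by (simp add: left_append mat_trace_mult_comm[of _ r r] left_carrier)
  have G_carr: "col G j \<in> carrier_vec r" if "j < m" for j using G that by auto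
  have L_carr: "left (ws ! j) \<in> carrier_mat r r" if "j < m" for j
    using ws[OF that] by (rule left_carrier)
  obtain H where H: "H \<in> carrier_mat r r" "H\<^sup>T = H"
    and HG: "\<And>j. j < m \<Longrightarrow> H *\<^sub>v col G j = left (ws ! j) *\<^sub>v z"
  proof (rule symmetric_extension[of "\<lambda>j. left (ws ! j) *\<^sub>v z"])
    fix i j assume ij: "i < m" "j < m"
    have "col G i \<bullet> (left (ws ! j) *\<^sub>v z) = (left (ws ! j) *\<^sub>v z) \<bullet> col G i"
      using ij z L_carr G_carr by (intro comm_scalar_prod[of _ r] mult_mat_vec_carrier[of _ r r]) auto
    also have "\<dots> = (left (ws ! j) *\<^sub>v z) \<bullet> (left (ws ! i) *\<^sub>v e)"
      using ij by (simp add: col_G)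
    also have "\<dots> = mat_trace (left (rev (rev (ws ! j) @ ws ! i)))"
      using ij ws by (subst tr_rev) (auto simp: tr_left)
    also have "\<dots> = (left (ws ! i) *\<^sub>v z) \<bullet> col G j"
      using ij ws by (simp add: col_G tr_left)
    finally show "col G i \<bullet> (left (ws ! j) *\<^sub>v z) = (left (ws ! i) *\<^sub>v z) \<bullet> col G j" .
  qed (use z L_carr in \<open>auto intro: mult_mat_vec_carrier\<close>)
  have H_inner: "col G i \<bullet> (H *\<^sub>v x) = (left (ws ! i) *\<^sub>v z) \<bullet> x"
    if "i < m" "x \<in> carrier_vec r" for i x
    using that H G_carr[of i] by (subst scalar_prod_mult_mat_vec_dim) (auto simp: HG dims)
  \<comment> \<open>The empty word is among the spanning words, so \<open>e\<close> is itself one of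
    the columns on which \<open>H\<close> is prescribed.\<close>
  have He: "H *\<^sub>v e = z"
  proof -
    obtain j where "j < m" "ws ! j = []" using Nil_in_ws by blast
    then show ?thesis using HG[of j] col_G[of j] e z by simp
  qed
  have "H * X l = X l * H" if l: "l < n" for l
  proof (rule mat_eqI)
    fix i j assume ij: "i < m" "j < m"
    let ?p = "ws ! i" and ?q = "ws ! j"
    have pq: "set ?p \<subseteq> {..<n}" "set ?q \<subseteq> {..<n}" using ws ij by auto
    have "col G i \<bullet> ((H * X l) *\<^sub>v col G j) = (left ?p *\<^sub>v z) \<bullet> (left (l # ?q) *\<^sub>v e)"
      using ij l X H G_carr L_carr e
      by (simp add: assoc_mult_mat_vec[of _ r r _ r] H_inner mult_mat_vec_carrier[of _ r r] col_G[of j])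
    also have "\<dots> = mat_trace (left (rev (rev ?p @ l # ?q)))"
      using pq l tr_left[of ?p "l # ?q"] tr_rev[of "rev ?p @ l # ?q"] by simp
    also have "\<dots> = (left ?q *\<^sub>v z) \<bullet> (left (l # ?p) *\<^sub>v e)"
      using pq l tr_left[of ?q "l # ?p"] by simp
    also have "\<dots> = (left (l # ?p) *\<^sub>v e) \<bullet> (left ?q *\<^sub>v z)"
      using pq l z e by (intro comm_scalar_prod[of _ r] mult_mat_vec_carrier[of _ r r] left_carrier) auto
    also have "\<dots> = (X l *\<^sub>v col G i) \<bullet> (H *\<^sub>v col G j)"
      using ij X l L_carr e by (simp add: col_G[of i] HG assoc_mult_mat_vec[of _ r r _ r])
    also have "\<dots> = col G i \<bullet> ((X l * H) *\<^sub>v col G j)"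
      using ij X[OF l] l H G_carr[of i] G_carr[of j]
      by (simp add: assoc_mult_mat_vec[of _ r r _ r] scalar_prod_mult_mat_vec_dim dims)
    finally show "col G i \<bullet> ((H * X l) *\<^sub>v col G j) = col G i \<bullet> ((X l * H) *\<^sub>v col G j)" .
  qed (use H(1) X(1)[OF l] in simp_all)
  moreover have "H * R l = R l * H" if l: "l < n" for l
  proof (rule mat_eqI)
    fix i j assume ij: "i < m" "j < m"
    let ?p = "ws ! i" and ?q = "ws ! j"
    have pq: "set ?p \<subseteq> {..<n}" "set ?q \<subseteq> {..<n}" using ws ij by auto
    have R_col: "R l *\<^sub>v col G k = left (ws ! k @ [l]) *\<^sub>v e" if k: "k < m" for k
    proof -
      have "R l *\<^sub>v col G k = (left (ws ! k) * R l) *\<^sub>v e"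
        using left_R_commute[OF l ws[OF k]] col_G[OF k] L_carr[OF k] R[OF l] e
        by (simp add: assoc_mult_mat_vec[of _ r r _ r])
      then show ?thesis
        using L_carr[OF k] R[OF l] X[OF l] e Xe[OF l] ws[OF k] l
        by (simp add: left_append assoc_mult_mat_vec[of _ r r _ r])
    qed
    have "col G i \<bullet> ((H * R l) *\<^sub>v col G j) = (left ?p *\<^sub>v z) \<bullet> (left (?q @ [l]) *\<^sub>v e)"
      using ij l R H G_carr
      by (simp add: assoc_mult_mat_vec[of _ r r _ r] H_inner mult_mat_vec_carrier[of _ r r]
        flip: R_col)
    also have "\<dots> = mat_trace (left ((rev ?p @ ?q) @ [l]))"
      using pq l tr_left[of ?p "?q @ [l]"] by simp
    also have "\<dots> = mat_trace (left (rev ([l] @ (rev ?p @ ?q))))"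
      using pq l tr_rev[of "[l] @ (rev ?p @ ?q)"] tr_rot[of "rev ?p @ ?q" "[l]"] by simp
    also have "\<dots> = (left ?q *\<^sub>v z) \<bullet> (left (?p @ [l]) *\<^sub>v e)"
      using pq l tr_left[of ?q "?p @ [l]"] by simp
    also have "\<dots> = (left (?p @ [l]) *\<^sub>v e) \<bullet> (left ?q *\<^sub>v z)"
      using pq l z e by (intro comm_scalar_prod[of _ r] mult_mat_vec_carrier[of _ r r] left_carrier) auto
    also have "\<dots> = (R l *\<^sub>v col G i) \<bullet> (H *\<^sub>v col G j)"
      using ij by (simp only: R_col HG)
    also have "\<dots> = col G i \<bullet> ((R l * H) *\<^sub>v col G j)"
      using ij R[OF l] l H G_carr[of i] G_carr[of j]
      by (simp add: assoc_mult_mat_vec[of _ r r _ r] scalar_prod_mult_mat_vec_dim dims)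
    finally show "col G i \<bullet> ((H * R l) *\<^sub>v col G j) = col G i \<bullet> ((R l * H) *\<^sub>v col G j)" .
  qed (use H(1) R(1)[OF l] in simp_all)
  ultimately show ?thesis using H tr He by (intro exI[of _ H]) auto
qed

end

section \<open>Functions of a symmetric matrix and decomposition along eigenspaces\<close>

lemma smult_mat_mult_vec:
  "dim_col A = dim_vec x \<Longrightarrow> (c \<cdot>\<^sub>m A) *\<^sub>v x = c \<cdot>\<^sub>v (A *\<^sub>v x)" for A :: "real mat"
  by (intro eq_vecI) (auto simp: scalar_prod_def sum_distrib_left mult.assoc)

text \<open>In the eigenbasis, commuting with the diagonal matrix means that the entry at
  \<open>(i, j)\<close> vanishes unless \<open>d i = d j\<close>, and in that case
  \<open>f (d i) = f (d j)\<close>. Indicator functions for \<open>f\<close> yield the spectral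
  projections.\<close>

lemma commute_diagonal_fun:
  fixes U B :: "real mat"
  assumes U: "U \<in> carrier_mat r r" "U\<^sup>T * U = 1\<^sub>m r" and B: "B \<in> carrier_mat r r"
    and comm: "U * mat_diag r d * U\<^sup>T * B = B * (U * mat_diag r d * U\<^sup>T)"
  shows "U * mat_diag r (\<lambda>i. f (d i)) * U\<^sup>T * B = B * (U * mat_diag r (\<lambda>i. f (d i)) * U\<^sup>T)"
proof -
  have UU: "U * U\<^sup>T = 1\<^sub>m r"
    by (rule mat_mult_left_right_inverse[OF _ U(1,2)]) (use U in simp)
  have dims: "dim_row U = r" "dim_col U = r" "dim_row B = r" "dim_col B = r"
    using U B by auto
  have cancel: "U\<^sup>T * (U * Y) = Y" "U * (U\<^sup>T * Y) = Y" if "dim_row Y = r" for Y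
    using that U(2) UU dims by (metis assoc_mult_mat_dim index_transpose_mat(2,3) left_mult_one_mat')+
  define B' where "B' = U\<^sup>T * B * U"
  have B': "B' \<in> carrier_mat r r" using U B by (simp add: B'_def)
  have B_eq: "B = U * (B' * U\<^sup>T)"
    using dims B by (simp add: B'_def mat_dim_simps cancel UU)
  have "mat_diag r d * B' = U\<^sup>T * (U * mat_diag r d * U\<^sup>T * B) * U"
    using dims by (simp add: B'_def mat_dim_simps cancel)
  also have "\<dots> = B' * mat_diag r d"
    unfolding comm using dims U(2) by (simp add: B'_def mat_dim_simps)
  finally have comm': "mat_diag r d * B' = B' * mat_diag r d" .
  have "mat_diag r (\<lambda>i. f (d i)) * B' = B' * mat_diag r (\<lambda>i. f (d i))"
  proof (rule eq_matI)
    fix i j assume "i < dim_row (B' * mat_diag r (\<lambda>i. f (d i)))" "j < dim_col (B' * mat_diag r (\<lambda>i. f (d i)))"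
    then have ij: "i < r" "j < r" using B' dims by auto
    have "d i * B' $$ (i, j) = B' $$ (i, j) * d j"
      using arg_cong[OF comm', of "\<lambda>M. M $$ (i, j)"] ij
      by (simp add: mat_diag_mult_left[OF B'] mat_diag_mult_right[OF B'])
    then have "B' $$ (i, j) = 0 \<or> d i = d j" by auto
    then show "(mat_diag r (\<lambda>i. f (d i)) * B') $$ (i, j) = (B' * mat_diag r (\<lambda>i. f (d i))) $$ (i, j)"
      using ij by (auto simp: mat_diag_mult_left[OF B'] mat_diag_mult_right[OF B'])
  qed (use B' dims in auto)
  then have *: "mat_diag r (\<lambda>i. f (d i)) * (B' * U\<^sup>T) = B' * (mat_diag r (\<lambda>i. f (d i)) * U\<^sup>T)"
    using B' dims by (simp flip: assoc_mult_mat_dim)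
  define D where "D = mat_diag r (\<lambda>i. f (d i))"
  have D: "dim_row D = r" "dim_col D = r" by (simp_all add: D_def)
  note dims = dims carrier_matD[OF B'] D
  have "U * D * U\<^sup>T * B = U * (D * (U\<^sup>T * (U * (B' * U\<^sup>T))))"
    using dims by (simp add: assoc_mult_mat_dim flip: B_eq)
  also have "\<dots> = U * (B' * (D * U\<^sup>T))"
    using dims by (simp add: cancel *[folded D_def])
  also have "\<dots> = (U * (B' * U\<^sup>T)) * (U * (D * U\<^sup>T))"
    using dims by (simp add: assoc_mult_mat_dim cancel)
  also have "\<dots> = B * (U * D * U\<^sup>T)"
    using dims by (simp add: assoc_mult_mat_dim flip: B_eq)
  finally show ?thesis unfolding D_def .
qed

context tracial_representation
begin

text \<open>With \<open>H = \<Sum>\<lambda> P\<^sub>\<lambda>\<close> the density above, \<open>tr (P\<^sub>\<lambda> w) = \<lambda> \<langle>e, P\<^sub>\<lambda> w e\<rangle>\<close>. Eigenvalues are counted with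
  multiplicity, so that the \<open>i\<close>-th summand carries weight \<open>1 / d i\<close>.\<close>

lemma tracial_decomposition:
  shows "\<exists>(d :: nat \<Rightarrow> real) (k :: nat \<Rightarrow> nat) (C :: nat \<Rightarrow> nat \<Rightarrow> real mat).
    (\<forall>i<r. 0 < d i \<and> 0 < k i \<and> (\<forall>l<n. C i l \<in> carrier_mat (k i) (k i) \<and> (C i l)\<^sup>T = C i l)) \<and>
    (\<forall>w. set w \<subseteq> {..<n} \<longrightarrow>
       e \<bullet> (left w *\<^sub>v e) = (\<Sum>i<r. 1 / d i * (mat_trace (word_eval (k i) (C i) w) / k i)))"
proof -
  obtain H where H: "H \<in> carrier_mat r r" "H\<^sup>T = H"
    and comm: "\<forall>l<n. H * X l = X l * H" "\<forall>l<n. H * R l = R l * H"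
    and trace: "\<forall>Q \<in> carrier_mat r r. (\<forall>l<n. Q * R l = R l * Q) \<longrightarrow>
      mat_trace Q = (H *\<^sub>v e) \<bullet> (Q *\<^sub>v e)"
    using central_density by (elim exE conjE) (rule that; assumption)
  note HX = comm(1)[rule_format] and HR = comm(2)[rule_format]
  have tr: "mat_trace Q = (H *\<^sub>v e) \<bullet> (Q *\<^sub>v e)"
    if "Q \<in> carrier_mat r r" "\<And>l. l < n \<Longrightarrow> Q * R l = R l * Q" for Q
    using trace that by blast
  obtain U d where U: "U \<in> carrier_mat r r" "U\<^sup>T * U = 1\<^sub>m r" and H_eq: "H = U * mat_diag r d * U\<^sup>T"
    using symmetric_real_diagonalization[OF H] .
  have UU: "U * U\<^sup>T = 1\<^sub>m r"
    by (rule mat_mult_left_right_inverse[OF _ U]) (use U in simp)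
  define k where "k i = length (filter (\<lambda>j. d j = d i) [0..<r])" for i
  define S where "S i = selection_mat r (\<lambda>j. d j = d i) (\<lambda>_. 1)" for i
  \<comment> \<open>The columns of \<open>V i\<close> are an orthonormal basis of the eigenspace of
    \<open>H\<close> for \<open>d i\<close>, and \<open>P i\<close> is the orthogonal projection
    onto it. Indices with equal eigenvalues give the same \<open>V i\<close>.\<close>
  define V where "V i = U * S i" for i
  define \<delta> where "\<delta> i = mat_diag r (\<lambda>j. if d j = d i then 1 else 0 :: real)" for i
  define P where "P i = V i * (V i)\<^sup>T" for i
  have dimX: "dim_row (X l) = r" "dim_col (X l) = r" if "l < n" for l
    using X(1)[OF that] by auto
  have dimS: "dim_row (S i) = r" "dim_col (S i) = k i" for i by (simp_all add: S_def k_def)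
  have dimU: "dim_row U = r" "dim_col U = r" "dim_vec e = r" using U e by auto
  have dimV: "dim_row (V i) = r" "dim_col (V i) = k i" for i by (simp_all add: V_def dimS dimU)
  have dim\<delta>: "dim_row (\<delta> i) = r" "dim_col (\<delta> i) = r" for i by (simp_all add: \<delta>_def mat_diag_def)
  have V: "V i \<in> carrier_mat r (k i)" for i by (rule carrier_matI) (simp_all add: dimV)
  have \<delta>: "\<delta> i \<in> carrier_mat r r" for i by (simp add: \<delta>_def)
  have P: "P i \<in> carrier_mat r r" for i by (rule carrier_matI) (simp_all add: P_def dimV)
  then have dimP: "dim_row (P i) = r" "dim_col (P i) = r" for i by auto
  have k_pos: "0 < k i" if "i < r" for i
  proof -
    have "i \<in> set (filter (\<lambda>j. d j = d i) [0..<r])" using that by simp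
    then show ?thesis unfolding k_def by (rule length_pos_if_in_set)
  qed
  have k_card: "k i = card {j. j < r \<and> d j = d i}" for i
  proof -
    have "{j. j < r \<and> d j = d i} = set (filter (\<lambda>j. d j = d i) [0..<r])" by auto
    then show ?thesis
      unfolding k_def by (metis distinct_card distinct_filter distinct_upt)
  qed
  have VV: "(V i)\<^sup>T * V i = 1\<^sub>m (k i)" for i
  proof -
    have "(V i)\<^sup>T * V i = (S i)\<^sup>T * ((U\<^sup>T * U) * S i)"
      by (simp add: V_def mat_dim_simps dimS dimU)
    also have "\<dots> = (S i)\<^sup>T * S i"
      using left_mult_one_mat'[of "S i" r] by (simp add: U(2) dimS)
    also have "\<dots> = 1\<^sub>m (k i)"
      unfolding S_def k_def by (rule selection_mat_transpose_mult) simp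
    finally show ?thesis .
  qed
  have P_eq: "P i = U * \<delta> i * U\<^sup>T" for i
  proof -
    have "P i = U * (S i * (S i)\<^sup>T) * U\<^sup>T"
      by (simp add: P_def V_def mat_dim_simps dimS dimU)
    then show ?thesis by (simp only: S_def selection_mat_mult_transpose \<delta>_def mult_1)
  qed
  \<comment> \<open>The projection is the function of \<open>H\<close> given by the indicator of
    \<open>d i\<close>, so it commutes with everything that commutes with \<open>H\<close>.\<close>
  have P_commute: "P i * B = B * P i" if "B \<in> carrier_mat r r" "H * B = B * H" for i B
    using commute_diagonal_fun[OF U that(1), of d "\<lambda>x. if x = d i then 1 else 0"] that(2)
    by (simp add: P_eq H_eq \<delta>_def)
  have HP: "H * P i = d i \<cdot>\<^sub>m P i" for i
  proof -
    have dd: "mat_diag r d * \<delta> i = d i \<cdot>\<^sub>m \<delta> i"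
      unfolding \<delta>_def mat_diag_diag by (rule eq_matI) (auto simp: mat_diag_def)
    have "H * P i = U * mat_diag r d * ((U\<^sup>T * U) * (\<delta> i * U\<^sup>T))"
      by (simp add: H_eq P_eq mat_dim_simps dimU dim\<delta> mat_diag_def)
    also have "\<dots> = U * (mat_diag r d * \<delta> i) * U\<^sup>T"
      using left_mult_one_mat'[of "\<delta> i * U\<^sup>T" r]
      by (simp add: U(2) mat_dim_simps dimU dim\<delta> mat_diag_def)
    also have "\<dots> = d i \<cdot>\<^sub>m P i"
    proof -
      have "U * \<delta> i \<in> carrier_mat r r" "U\<^sup>T \<in> carrier_mat r r" using U(1) \<delta>[of i] by auto
      then show ?thesis
        unfolding dd P_eq mult_smult_distrib[OF U(1) \<delta>] by (rule mult_smult_assoc_mat)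
    qed
    finally show ?thesis .
  qed
  define C where "C i l = (V i)\<^sup>T * (X l * V i)" for i l
  have C: "C i l \<in> carrier_mat (k i) (k i)" for i l
    by (rule carrier_matI) (simp_all add: C_def dimV)
  have C_sym: "(C i l)\<^sup>T = C i l" if "l < n" for i l
    using that dimX[OF that] X(2)[OF that] by (simp add: C_def mat_dim_simps dimV)
  have VP: "(V i)\<^sup>T * P i = (V i)\<^sup>T" for i
  proof -
    have "(V i)\<^sup>T * P i = ((V i)\<^sup>T * V i) * (V i)\<^sup>T" by (simp add: P_def mat_dim_simps dimV)
    then show ?thesis by (simp add: VV dimV)
  qed
  \<comment> \<open>Compression to an eigenspace is multiplicative on words because
    \<open>P i\<close> commutes with every \<open>X l\<close> and can be absorbed into
    \<open>(V i)\<^sup>T\<close>.\<close>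
  have eval_C: "word_eval (k i) (C i) w = (V i)\<^sup>T * (left w * V i)" if "set w \<subseteq> {..<n}" for i w
    using that
  proof (induction w)
    case Nil
    then show ?case using left_mult_one_mat'[of "V i" r] by (simp add: dimV VV)
  next
    case (Cons l w)
    then have l: "l < n" and w: "set w \<subseteq> {..<n}" by auto
    have W: "dim_row (left w) = r" "dim_col (left w) = r" using left_carrier[OF w] by auto
    have "word_eval (k i) (C i) (l # w) = (V i)\<^sup>T * ((X l * P i) * (left w * V i))"
      using Cons.IH[OF w] dimX[OF l] W by (simp add: C_def[of i l] P_def mat_dim_simps dimV)
    also have "\<dots> = ((V i)\<^sup>T * P i) * (X l * (left w * V i))"
      using P_commute[OF X(1)[OF l] HX[OF l], of i, symmetric] dimX[OF l] W
      by (simp add: assoc_mult_mat_dim dimV dimP)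
    also have "\<dots> = (V i)\<^sup>T * (left (l # w) * V i)"
      using dimX[OF l] W by (simp add: VP mat_dim_simps dimV)
    finally show ?case .
  qed
  \<comment> \<open>Cyclicity turns the left side into the trace of \<open>left w * P i\<close>,
    which commutes with all \<open>R l\<close>, so the density formula applies. Symmetry of
    \<open>H\<close> moves it next to \<open>P i\<close>, where it acts as the scalar
    \<open>d i\<close>.\<close>
  have trace_C: "mat_trace (word_eval (k i) (C i) w) = d i * (e \<bullet> (left w *\<^sub>v (P i *\<^sub>v e)))"
    if w: "set w \<subseteq> {..<n}" for i w
  proof -
    note W = left_carrier[OF w]
    then have dimW: "dim_row (left w) = r" "dim_col (left w) = r" by auto
    have HW: "H * left w = left w * H"
      by (rule word_eval_commute[OF X(1) H(1) HX w])
    have "mat_trace (word_eval (k i) (C i) w) = mat_trace ((left w * V i) * (V i)\<^sup>T)"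
      unfolding eval_C[OF w] by (rule mat_trace_mult_comm) (use W V[of i] in auto)
    also have "\<dots> = mat_trace (left w * P i)"
      by (simp add: P_def mat_dim_simps dimV dimW)
    also have "\<dots> = (H *\<^sub>v e) \<bullet> ((left w * P i) *\<^sub>v e)"
    proof (rule tr)
      fix l assume l: "l < n"
      have dimR: "dim_row (R l) = r" "dim_col (R l) = r" using R(1)[OF l] by auto
      have "left w * P i * R l = left w * (P i * R l)"
        using dimR dimW dimP by (simp add: assoc_mult_mat_dim)
      also have "\<dots> = (left w * R l) * P i"
        unfolding P_commute[OF R(1)[OF l] HR[OF l]]
        using dimR dimW dimP by (simp add: assoc_mult_mat_dim)
      also have "\<dots> = R l * (left w * P i)"
        unfolding left_R_commute[OF l w] using dimR dimW dimP by (simp add: assoc_mult_mat_dim)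
      finally show "left w * P i * R l = R l * (left w * P i)" .
    qed (use W P in simp)
    also have "\<dots> = e \<bullet> ((H * (left w * P i)) *\<^sub>v e)"
      using H dimU dimW dimP
      by (simp add: scalar_prod_mult_mat_vec_dim assoc_mult_mat_vec_dim carrier_matD[OF H(1)])
    also have "H * (left w * P i) = (H * left w) * P i"
      using dimW dimP H(1) by (simp add: assoc_mult_mat_dim)
    also have "\<dots> = left w * (H * P i)"
      unfolding HW using dimW dimP H(1) by (simp add: assoc_mult_mat_dim)
    also have "\<dots> = d i \<cdot>\<^sub>m (left w * P i)"
      unfolding HP using W P[of i] by (rule mult_smult_distrib)
    also have "e \<bullet> ((d i \<cdot>\<^sub>m (left w * P i)) *\<^sub>v e) = d i * (e \<bullet> ((left w * P i) *\<^sub>v e))"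
    proof -
      have "(d i \<cdot>\<^sub>m (left w * P i)) *\<^sub>v e = d i \<cdot>\<^sub>v ((left w * P i) *\<^sub>v e)"
        using dimP dimU by (intro smult_mat_mult_vec) simp
      then show ?thesis using e W P[of i] by simp
    qed
    finally show ?thesis using dimW dimP dimU by (simp add: assoc_mult_mat_vec_dim)
  qed
  \<comment> \<open>For the empty word, \<open>trace_C\<close> equates the positive number
    \<open>k i\<close> with \<open>d i\<close> times a squared norm.\<close>
  have d_pos: "0 < d i" if "i < r" for i
  proof -
    have "real (k i) = d i * (e \<bullet> (P i *\<^sub>v e))"
      using trace_C[of "[]" i] e P[of i] by (simp add: mat_trace_def)
    also have "e \<bullet> (P i *\<^sub>v e) = ((V i)\<^sup>T *\<^sub>v e) \<bullet> ((V i)\<^sup>T *\<^sub>v e)"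
      using dimU dimV by (simp add: P_def mat_dim_simps scalar_prod_mult_mat_vec_dim)
    finally have "0 < d i * (((V i)\<^sup>T *\<^sub>v e) \<bullet> ((V i)\<^sup>T *\<^sub>v e))"
      using k_pos[OF that] by simp
    moreover have "0 \<le> ((V i)\<^sup>T *\<^sub>v e) \<bullet> ((V i)\<^sup>T *\<^sub>v e)"
      by (simp add: scalar_prod_def sum_nonneg)
    ultimately show ?thesis by (simp add: zero_less_mult_iff)
  qed
  have "e \<bullet> (left w *\<^sub>v e) = (\<Sum>i<r. 1 / d i * (mat_trace (word_eval (k i) (C i) w) / k i))"
    if w: "set w \<subseteq> {..<n}" for w
  proof -
    note W = left_carrier[OF w]
    then have dimW: "dim_row (left w) = r" "dim_col (left w) = r" by auto
    \<comment> \<open>In eigenbasis coordinates, \<open>\<alpha>\<close> and \<open>\<beta>\<close>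
      turn the full scalar product into one sum over \<open>j\<close>, and inserting
      \<open>P i\<close> merely restricts this sum to \<open>d j = d i\<close>.\<close>
    define \<alpha> where "\<alpha> = U\<^sup>T *\<^sub>v ((left w)\<^sup>T *\<^sub>v e)"
    define \<beta> where "\<beta> = U\<^sup>T *\<^sub>v e"
    have dim\<alpha>: "dim_vec \<alpha> = r" "dim_vec \<beta> = r" by (simp_all add: \<alpha>_def \<beta>_def dimU)
    have \<alpha>_prod: "e \<bullet> (left w *\<^sub>v (U *\<^sub>v x)) = \<alpha> \<bullet> x" if "dim_vec x = r" for x
      using scalar_prod_mult_mat_vec_dim[of e "left w" "U *\<^sub>v x"]
        scalar_prod_mult_mat_vec_dim[of "(left w)\<^sup>T *\<^sub>v e" U x] dimW dimU that
      by (simp add: \<alpha>_def)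
    have "e = U *\<^sub>v \<beta>"
      using assoc_mult_mat_vec_dim[of U "U\<^sup>T" e] UU e dimU by (simp add: \<beta>_def)
    then have "e \<bullet> (left w *\<^sub>v e) = e \<bullet> (left w *\<^sub>v (U *\<^sub>v \<beta>))" by simp
    also have "\<dots> = (\<Sum>j<r. \<alpha> $ j * \<beta> $ j)"
      using dim\<alpha> by (simp add: \<alpha>_prod) (simp add: scalar_prod_def atLeast0LessThan)
    finally have total: "e \<bullet> (left w *\<^sub>v e) = (\<Sum>j<r. \<alpha> $ j * \<beta> $ j)" .
    have part: "e \<bullet> (left w *\<^sub>v (P i *\<^sub>v e)) = (\<Sum>j<r. if d j = d i then \<alpha> $ j * \<beta> $ j else 0)" for i
    proof -
      have "e \<bullet> (left w *\<^sub>v (P i *\<^sub>v e)) = e \<bullet> (left w *\<^sub>v (U *\<^sub>v (\<delta> i *\<^sub>v \<beta>)))"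
        using dimU dim\<delta> by (simp add: P_eq mat_dim_simps \<beta>_def)
      also have "\<dots> = \<alpha> \<bullet> (\<delta> i *\<^sub>v \<beta>)"
        using dim\<delta> by (intro \<alpha>_prod) simp
      also have "\<dots> = (\<Sum>j<r. \<alpha> $ j * (\<delta> i *\<^sub>v \<beta>) $ j)"
        using dim\<delta>[of i] by (simp add: scalar_prod_def atLeast0LessThan del: index_mult_mat_vec)
      also have "\<dots> = (\<Sum>j<r. if d j = d i then \<alpha> $ j * \<beta> $ j else 0)"
      proof (rule sum.cong)
        fix j assume "j \<in> {..<r}"
        then have j: "j < r" by simp
        have "(\<delta> i *\<^sub>v \<beta>) $ j = (\<Sum>c<r. (if j = c then if d c = d i then 1 else 0 else 0) * \<beta> $ c)"
          using j dim\<alpha> by (simp add: \<delta>_def mat_diag_def scalar_prod_def atLeast0LessThan)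
        also have "\<dots> = (\<Sum>c<r. if c = j then if d j = d i then \<beta> $ j else 0 else 0)"
          by (intro sum.cong) auto
        finally show "\<alpha> $ j * (\<delta> i *\<^sub>v \<beta>) $ j = (if d j = d i then \<alpha> $ j * \<beta> $ j else 0)"
          using j by simp
      qed simp
      finally show ?thesis .
    qed
    have "(\<Sum>i<r. 1 / d i * (mat_trace (word_eval (k i) (C i) w) / k i))
        = (\<Sum>i<r. \<Sum>j<r. if d j = d i then \<alpha> $ j * \<beta> $ j / k j else 0)"
    proof (rule sum.cong)
      fix i assume "i \<in> {..<r}"
      then have "d i \<noteq> 0" using d_pos[of i] by simp
      then have "1 / d i * (mat_trace (word_eval (k i) (C i) w) / k i)
          = (\<Sum>j<r. if d j = d i then \<alpha> $ j * \<beta> $ j else 0) / k i"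
        by (simp add: trace_C[OF w] part)
      also have "\<dots> = (\<Sum>j<r. if d j = d i then \<alpha> $ j * \<beta> $ j / k j else 0)"
        unfolding sum_divide_distrib by (intro sum.cong) (auto simp: k_def)
      finally show "1 / d i * (mat_trace (word_eval (k i) (C i) w) / k i)
          = (\<Sum>j<r. if d j = d i then \<alpha> $ j * \<beta> $ j / k j else 0)" .
    qed simp
    \<comment> \<open>After the exchange, each \<open>j\<close> is hit by exactly \<open>k j\<close>
      indices \<open>i\<close>, which cancels the division by \<open>k j\<close>.\<close>
    also have "\<dots> = (\<Sum>j<r. \<Sum>i<r. if d j = d i then \<alpha> $ j * \<beta> $ j / k j else 0)"
      by (rule sum.swap)
    also have "\<dots> = (\<Sum>j<r. \<alpha> $ j * \<beta> $ j)"
    proof (rule sum.cong)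
      fix j assume "j \<in> {..<r}"
      then have "k j \<noteq> 0" using k_pos[of j] by simp
      have "(\<Sum>i<r. if d j = d i then \<alpha> $ j * \<beta> $ j / k j else 0)
          = (\<Sum>i\<in>{i. i < r \<and> d i = d j}. \<alpha> $ j * \<beta> $ j / k j)"
        by (rule sum.mono_neutral_cong_right) auto
      also have "\<dots> = \<alpha> $ j * \<beta> $ j" using \<open>k j \<noteq> 0\<close> by (simp add: k_card[symmetric])
      finally show "(\<Sum>i<r. if d j = d i then \<alpha> $ j * \<beta> $ j / k j else 0) = \<alpha> $ j * \<beta> $ j" .
    qed simp
    finally show ?thesis using total by simp
  qed
  then show ?thesis using d_pos k_pos C C_sym by blast
qed

end

section \<open>Blocks of a common size and the convex combination\<close>

text \<open>Brings the blocks of different sizes \<open>k i\<close> above to a common size without changing normalized traces.\<close>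

lemma amplification:
  fixes C :: "nat \<Rightarrow> real mat"
  assumes C: "\<And>l. l < n \<Longrightarrow> C l \<in> carrier_mat k k" "\<And>l. l < n \<Longrightarrow> (C l)\<^sup>T = C l"
  obtains C' where "\<And>l. l < n \<Longrightarrow> C' l \<in> carrier_mat (q * k) (q * k)"
    "\<And>l. l < n \<Longrightarrow> (C' l)\<^sup>T = C' l"
    "\<And>w. set w \<subseteq> {..<n} \<Longrightarrow> mat_trace (word_eval (q * k) C' w) = q * mat_trace (word_eval k C w)"
proof -
  have "\<exists>C'. (\<forall>l<n. C' l \<in> carrier_mat (q * k) (q * k) \<and> (C' l)\<^sup>T = C' l) \<and>
    (\<forall>w. set w \<subseteq> {..<n} \<longrightarrow> mat_trace (word_eval (q * k) C' w) = q * mat_trace (word_eval k C w))"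
  proof (induction q)
    case 0
    have "dim_row (word_eval 0 (\<lambda>_. 1\<^sub>m 0 :: real mat) w) = 0" for w by (cases w) auto
    then show ?case by (intro exI[of _ "\<lambda>_. 1\<^sub>m 0"]) (auto simp: mat_trace_def)
  next
    case (Suc q)
    let ?K = "q * k"
    obtain B where B: "\<And>l. l < n \<Longrightarrow> B l \<in> carrier_mat ?K ?K" "\<And>l. l < n \<Longrightarrow> (B l)\<^sup>T = B l"
      and trB: "\<And>w. set w \<subseteq> {..<n} \<Longrightarrow> mat_trace (word_eval ?K B w) = q * mat_trace (word_eval k C w)"
      using Suc.IH by blast
    \<comment> \<open>One further copy of \<open>C l\<close> is added as a diagonal block; words are
      evaluated blockwise, so traces add.\<close>
    define C' where "C' l = four_block_mat (C l) (0\<^sub>m k ?K) (0\<^sub>m ?K k) (B l)" for l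
    have C': "C' l \<in> carrier_mat (Suc q * k) (Suc q * k)" "(C' l)\<^sup>T = C' l" if "l < n" for l
      using C[OF that] B[OF that]
      by (auto simp: C'_def transpose_four_block_mat[of _ k k _ ?K _ ?K])
    have eval: "word_eval (Suc q * k) C' w =
        four_block_mat (word_eval k C w) (0\<^sub>m k ?K) (0\<^sub>m ?K k) (word_eval ?K B w)"
      if "set w \<subseteq> {..<n}" for w
      using that
    proof (induction w)
      case Nil
      then show ?case by (auto intro!: eq_matI)
    next
      case (Cons l w)
      then show ?case
        using mult_block_diagonal[OF C(1)[of l] word_eval_carrier[of n C k w, OF C(1)]
            B(1)[of l] word_eval_carrier[of n B ?K w, OF B(1)]]
        by (simp add: C'_def)
    qed
    have "mat_trace (word_eval (Suc q * k) C' w) = Suc q * mat_trace (word_eval k C w)"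
      if w: "set w \<subseteq> {..<n}" for w
    proof -
      let ?E = "word_eval k C w" and ?F = "word_eval ?K B w"
      have EF: "dim_row ?E = k" "dim_col ?E = k" "dim_row ?F = ?K" "dim_col ?F = ?K"
        using word_eval_carrier[of n C k w, OF C(1) w] word_eval_carrier[of n B ?K w, OF B(1) w] by auto
      have split: "sum f {..<k + m} = sum f {..<k} + (\<Sum>i<m. f (k + i))" for f :: "nat \<Rightarrow> real" and m
        by (induction m) (simp_all add: add.assoc)
      have "mat_trace (word_eval (Suc q * k) C' w) =
          (\<Sum>i<k + ?K. if i < k then ?E $$ (i, i) else ?F $$ (i - k, i - k))"
        unfolding eval[OF w] mat_trace_def using EF by (intro sum.cong) auto
      also have "\<dots> = (\<Sum>i<k. ?E $$ (i, i)) + (\<Sum>i<?K. ?F $$ (i, i))"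
        by (simp add: split)
      also have "\<dots> = Suc q * mat_trace ?E"
        using trB[OF w] EF by (simp add: mat_trace_def algebra_simps)
      finally show ?thesis .
    qed
    then show ?case using C' by blast
  qed
  then show thesis using that by blast
qed

lemma normalized_trace_eq: "normalized_trace A = mat_trace A / dim_row A"
  by (simp add: normalized_trace_def mat_trace_def)

text \<open>The product of all block sizes is a multiple of each of them, so amplification brings
  every block to this size. Evaluating the decomposition at the empty word, where every normalized
  trace is one, shows that the weights \<open>1 / d i\<close> add up to
  \<open>e \<bullet> e = 1\<close>.\<close>

lemma (in tracial_representation) tracial_mixture:
  assumes unit: "e \<bullet> e = 1"
  shows "\<exists>(N::nat) (s::nat) (c :: nat \<Rightarrow> real) (A :: nat \<Rightarrow> nat \<Rightarrow> real mat).
    1 \<le> N \<and> 1 \<le> s \<and> (\<forall>i \<in> {1..N}. 0 \<le> c i) \<and> (\<Sum>i = 1..N. c i) = 1 \<and>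
    (\<forall>i \<in> {1..N}. \<forall>l<n. A i l \<in> carrier_mat s s \<and> symmetric_mat (A i l)) \<and>
    (\<forall>w. set w \<subseteq> {..<n} \<longrightarrow>
       e \<bullet> (left w *\<^sub>v e) = (\<Sum>i = 1..N. c i * normalized_trace (word_eval s (A i) w)))"
proof -
  have r: "0 < r" using unit e by (cases r) (auto simp: scalar_prod_def)
  obtain d k C where
    dkC: "\<forall>i<r. 0 < d i \<and> 0 < k i \<and> (\<forall>l<n. C i l \<in> carrier_mat (k i) (k i) \<and> (C i l)\<^sup>T = C i l)"
    and eq: "\<forall>w. set w \<subseteq> {..<n} \<longrightarrow>
       e \<bullet> (left w *\<^sub>v e) = (\<Sum>i<r. 1 / d i * (mat_trace (word_eval (k i) (C i) w) / k i))"
    using tracial_decomposition by blast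
  have d: "\<And>i. i < r \<Longrightarrow> 0 < d i" and k: "\<And>i. i < r \<Longrightarrow> 0 < k i"
    and C: "\<And>i l. i < r \<Longrightarrow> l < n \<Longrightarrow> C i l \<in> carrier_mat (k i) (k i)"
      "\<And>i l. i < r \<Longrightarrow> l < n \<Longrightarrow> (C i l)\<^sup>T = C i l"
    using dkC by blast+
  define s where "s = (\<Prod>i<r. k i)"
  have s: "0 < s" using k by (auto simp: s_def intro: prod_pos)
  have "\<exists>B. (\<forall>l<n. B l \<in> carrier_mat s s \<and> (B l)\<^sup>T = B l) \<and>
      (\<forall>w. set w \<subseteq> {..<n} \<longrightarrow>
         normalized_trace (word_eval s B w) = mat_trace (word_eval (k i) (C i) w) / k i)"
    if i: "i < r" for i
  proof -
    have "k i dvd s" using i by (auto simp: s_def)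
    then obtain q where q: "s = q * k i" by (metis dvdE mult.commute)
    obtain B where B: "\<And>l. l < n \<Longrightarrow> B l \<in> carrier_mat s s" "\<And>l. l < n \<Longrightarrow> (B l)\<^sup>T = B l"
      "\<And>w. set w \<subseteq> {..<n} \<Longrightarrow> mat_trace (word_eval s B w) = q * mat_trace (word_eval (k i) (C i) w)"
      using amplification[of n "C i" "k i" q, OF C[OF i]] unfolding q by blast
    have "normalized_trace (word_eval s B w) = mat_trace (word_eval (k i) (C i) w) / k i"
      if w: "set w \<subseteq> {..<n}" for w
    proof -
      have "dim_row (word_eval s B w) = s" using word_eval_carrier[of n B s w, OF B(1) w] by simp
      then show ?thesis
        using B(3)[OF w] q s by (simp add: normalized_trace_eq)
    qed
    then show ?thesis using B by blast
  qed
  then obtain B where B: "\<And>i l. i < r \<Longrightarrow> l < n \<Longrightarrow> B i l \<in> carrier_mat s s \<and> (B i l)\<^sup>T = B i l"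
    and trB: "\<And>i w. i < r \<Longrightarrow> set w \<subseteq> {..<n} \<Longrightarrow>
       normalized_trace (word_eval s (B i) w) = mat_trace (word_eval (k i) (C i) w) / k i"
    by metis
  \<comment> \<open>The eigenvalues are numbered from zero, whereas the required convex combination
    is indexed from one.\<close>
  have shift: "(\<Sum>i = 1..r. f (i - 1)) = (\<Sum>i<r. f i)" for f :: "nat \<Rightarrow> real"
    by (rule sum.reindex_bij_witness[of _ Suc "\<lambda>i. i - 1"]) auto
  have mix: "e \<bullet> (left w *\<^sub>v e) = (\<Sum>i<r. 1 / d i * normalized_trace (word_eval s (B i) w))"
    if "set w \<subseteq> {..<n}" for w
    using eq that trB[OF _ that] by simp
  have "(\<Sum>i<r. 1 / d i) = 1"
    using mix[of "[]"] unit e s by (simp add: normalized_trace_def)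
  then have sum_c: "(\<Sum>i = 1..r. 1 / d (i - 1)) = 1"
    unfolding shift[of "\<lambda>i. 1 / d i"] .
  show ?thesis
  proof (intro exI conjI ballI allI impI)
    fix w assume "set w \<subseteq> {..<n}"
    then show "e \<bullet> (left w *\<^sub>v e) =
        (\<Sum>i = 1..r. 1 / d (i - 1) * normalized_trace (word_eval s (B (i - 1)) w))"
      unfolding shift[of "\<lambda>i. 1 / d i * normalized_trace (word_eval s (B i) w)"] by (rule mix)
  next
    fix i assume "i \<in> {1..r}"
    then have i: "i - 1 < r" by auto
    show "0 \<le> 1 / d (i - 1)" using d[OF i] by simp
    show "B (i - 1) l \<in> carrier_mat s s" "symmetric_mat (B (i - 1) l)" if "l < n" for l
      using B[OF i that] by (auto simp: symmetric_mat_def)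
  qed (use r s sum_c in auto)
qed

section \<open>Flat tracial sequences\<close>

theorem corollary3p19:
  fixes n k :: nat and y :: "nat list \<Rightarrow> real"
  assumes "1 \<le> k"
    and "truncated_tracial_sequence n (2 * k) y"
    and "psd_mat (tracial_moment_matrix n k y)"
    and "flat_extension (tracial_moment_matrix n k y) (tracial_moment_matrix n (k - 1) y)"
  shows "truncated_tracial_moment_sequence n (2 * k) y"
proof -
  define k' where "k' = k - 1"
  have k: "k = Suc k'" using assms(1) by (simp add: k'_def)
  define W where "W = word_list n k"
  define W0 where "W0 = word_list n k'"
  define N where "N = length W"
  define N0 where "N0 = length W0"
  have W_prefix: "W ! j = W0 ! j" "j < N" if "j < N0" for j
    using that by (auto simp: W_def W0_def N_def N0_def k word_list_Suc nth_append)
  have mem_W: "w \<in> words n k \<longleftrightarrow> (\<exists>i<N. W ! i = w)" for w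
    using set_word_list[of n k] by (auto simp: W_def N_def in_set_conv_nth set_eq_iff)
  have mem_W0: "w \<in> words n k' \<longleftrightarrow> (\<exists>i<N0. W0 ! i = w)" for w
    using set_word_list[of n k'] by (auto simp: W0_def N0_def in_set_conv_nth set_eq_iff)
  have W0_words: "W0 ! j \<in> words n k'" if "j < N0" for j using that mem_W0 by blast
  have y_rotate: "y (u @ v) = y (v @ u)" if "u @ v \<in> words n (2 * k)" for u v
  proof -
    have "cyc_equiv (u @ v) (v @ u)" unfolding cyc_equiv_def by (metis rotate_append)
    moreover have "v @ u \<in> words n (2 * k)" using that by (auto simp: words_def)
    ultimately show ?thesis
      using assms(2) that unfolding truncated_tracial_sequence_def by blast
  qed
  define M where "M = tracial_moment_matrix n k y"
  have M: "M \<in> carrier_mat N N" by (simp add: M_def tracial_moment_matrix_def N_def W_def)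
  have MT: "M\<^sup>T = M" using assms(3) by (simp add: psd_mat_def symmetric_mat_def M_def)
  have M_psd: "0 \<le> v \<bullet> (M *\<^sub>v v)" if "v \<in> carrier_vec N" for v
    using assms(3) that M by (auto simp: psd_mat_def M_def)
  \<comment> \<open>The inclusion of the first \<open>N0\<close> coordinates. As the words of degree
    at most \<open>k'\<close> come first in the enumeration, compressing \<open>M\<close> by
    \<open>P\<close> gives the moment matrix of order \<open>k'\<close>.\<close>
  define P where "P = mat N N0 (\<lambda>(i, j). if i = j then 1 else 0 :: real)"
  have P: "P \<in> carrier_mat N N0" by (simp add: P_def)
  have col_P: "col P j = unit_vec N j" if "j < N0" for j
    using W_prefix[OF that] that by (intro eq_vecI) (auto simp: P_def)
  have "P\<^sup>T * M * P = tracial_moment_matrix n k' y"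
  proof (rule eq_matI)
    fix i j assume "i < dim_row (tracial_moment_matrix n k' y)" "j < dim_col (tracial_moment_matrix n k' y)"
    then have ij: "i < N0" "j < N0" by (auto simp: tracial_moment_matrix_def N0_def W0_def)
    have "(P\<^sup>T * M * P) $$ (i, j) = (P\<^sup>T * (M * P)) $$ (i, j)"
      using P M by (simp add: assoc_mult_mat_dim)
    also have "\<dots> = unit_vec N i \<bullet> (M *\<^sub>v unit_vec N j)"
      using ij P M by (simp add: col_P col_mult2[of M N N P N0] del: col_mult)
    also have "\<dots> = M $$ (i, j)"
      using W_prefix[OF ij(1)] W_prefix[OF ij(2)] M
      by (simp add: scalar_prod_left_unit[of _ N] mult_mat_vec_carrier[of _ N N] row_def)
    also have "\<dots> = tracial_moment_matrix n k' y $$ (i, j)"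
      using ij W_prefix[OF ij(1)] W_prefix[OF ij(2)]
      by (simp add: M_def tracial_moment_matrix_def W_def W0_def N_def N0_def)
    finally show "(P\<^sup>T * M * P) $$ (i, j) = tracial_moment_matrix n k' y $$ (i, j)" .
  qed (use P in \<open>auto simp: tracial_moment_matrix_def N0_def W0_def\<close>)
  moreover have "mat_rank (tracial_moment_matrix n k' y) = mat_rank M"
    using assms(4) by (simp add: flat_extension_def k'_def M_def)
  ultimately have rank: "vec_space.rank N M \<le> vec_space.rank N0 (P\<^sup>T * M * P)"
    using M by (simp add: mat_rank_def tracial_moment_matrix_def N0_def W0_def)
  obtain r G D where G: "G \<in> carrier_mat r N" and D: "D \<in> carrier_mat N0 r"
    and GG: "G\<^sup>T * G = M" and GPD: "G * P * D = 1\<^sub>m r"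
    using flat_gram_factorization[OF M MT M_psd P rank] .
  define a where "a w = col G (SOME i. i < N \<and> W ! i = w)" for w
  have a_nth: "a (W ! i) = col G i" if "i < N" for i
  proof -
    have "(SOME j. j < N \<and> W ! j = W ! i) = i"
      using that distinct_word_list[of n k]
      by (intro some_equality) (auto simp: W_def N_def nth_eq_iff_index_eq)
    then show ?thesis by (simp add: a_def)
  qed
  have a: "a w \<in> carrier_vec r" if "w \<in> words n k" for w
    using that mem_W[of w] a_nth G by auto
  have inner: "a u \<bullet> a v = y (rev u @ v)" if uv: "u \<in> words n k" "v \<in> words n k" for u v
  proof -
    obtain i j where ij: "i < N" "W ! i = u" "j < N" "W ! j = v" using uv mem_W by metis
    have "a u \<bullet> a v = (G\<^sup>T * G) $$ (i, j)" using ij a_nth[of i] a_nth[of j] G by simp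
    also have "\<dots> = y (rev u @ v)"
      using ij by (simp add: GG M_def tracial_moment_matrix_def W_def N_def)
    finally show ?thesis .
  qed
  define G0 where "G0 = G * P"
  have G0: "G0 \<in> carrier_mat r N0" using G P by (simp add: G0_def)
  have col_G0: "col G0 j = a (W0 ! j)" if j: "j < N0" for j
  proof -
    have "col G0 j = G *\<^sub>v unit_vec N j"
      using col_mult2[OF G P j] col_P[OF j] by (simp add: G0_def)
    also have "\<dots> = col G j"
      using G W_prefix[OF j] by (intro eq_vecI) (auto simp: scalar_prod_right_unit[of _ N])
    finally show ?thesis using a_nth[of j] W_prefix[OF j] by simp
  qed
  \<comment> \<open>Here flatness takes effect: the vectors of words of degree at most
    \<open>k - 1\<close> span, so operators may be prescribed on them alone, with images of degree
    at most \<open>k\<close>.\<close>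
  interpret sc: spanning_columns r N0 G0 D
    by unfold_locales (use G0 D GPD in \<open>auto simp: G0_def\<close>)
  have short: "w \<in> words n k" "l # w \<in> words n k" "w @ [l] \<in> words n k" "rev w \<in> words n k"
    if "w \<in> words n k'" "l < n" for l w
    using that by (auto simp: words_def k)
  \<comment> \<open>The symmetry condition holds since both scalar products are the value of
    \<open>y\<close> at the same word, \<open>rev u @ l # v\<close>.\<close>
  have "\<exists>X. X \<in> carrier_mat r r \<and> X\<^sup>T = X \<and> (\<forall>j<N0. X *\<^sub>v a (W0 ! j) = a (l # W0 ! j))"
    if l: "l < n" for l
  proof (rule sc.symmetric_extension[of "\<lambda>j. a (l # W0 ! j)"])
    fix i j assume "i < N0" "j < N0"
    then show "col G0 i \<bullet> a (l # W0 ! j) = a (l # W0 ! i) \<bullet> col G0 j"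
      using l W0_words[of i] W0_words[of j] by (simp add: col_G0 inner short)
  qed (use l W0_words in \<open>auto intro: a short simp: col_G0\<close>)
  then obtain X where X: "\<And>l. l < n \<Longrightarrow> X l \<in> carrier_mat r r" "\<And>l. l < n \<Longrightarrow> (X l)\<^sup>T = X l"
    and X_nth: "\<And>l j. l < n \<Longrightarrow> j < N0 \<Longrightarrow> X l *\<^sub>v a (W0 ! j) = a (l # W0 ! j)"
    by metis
  \<comment> \<open>Now the two scalar products are values of \<open>y\<close> at words that differ
    by moving the letter \<open>l\<close> from the end to the front, so cyclic invariance is
    needed.\<close>
  have "\<exists>R. R \<in> carrier_mat r r \<and> R\<^sup>T = R \<and> (\<forall>j<N0. R *\<^sub>v a (W0 ! j) = a (W0 ! j @ [l]))"
    if l: "l < n" for l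
  proof (rule sc.symmetric_extension[of "\<lambda>j. a (W0 ! j @ [l])"])
    fix i j assume "i < N0" "j < N0"
    then show "col G0 i \<bullet> a (W0 ! j @ [l]) = a (W0 ! i @ [l]) \<bullet> col G0 j"
      using l W0_words[of i] W0_words[of j] y_rotate[of "rev (W0 ! i) @ W0 ! j" "[l]"]
      by (simp add: col_G0 inner short) (auto simp: words_def k)
  qed (use l W0_words in \<open>auto intro: a short simp: col_G0\<close>)
  then obtain R where R: "\<And>l. l < n \<Longrightarrow> R l \<in> carrier_mat r r" "\<And>l. l < n \<Longrightarrow> (R l)\<^sup>T = R l"
    and R_nth: "\<And>l j. l < n \<Longrightarrow> j < N0 \<Longrightarrow> R l *\<^sub>v a (W0 ! j) = a (W0 ! j @ [l])"
    by metis
  have X_a: "X l *\<^sub>v a w = a (l # w)" "R l *\<^sub>v a w = a (w @ [l])" if "l < n" "w \<in> words n k'" for l w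
    using that mem_W0[of w] X_nth R_nth by metis+
  have Nil: "[] \<in> words n k'" "[] \<in> words n k" by (auto simp: words_def)
  \<comment> \<open>The last letter applied acts on a word of degree at most \<open>k - 1\<close>,
    which is why the formula reaches degree \<open>k\<close>.\<close>
  have eval: "word_eval r X w *\<^sub>v a [] = a w" if "w \<in> words n k" for w
    using that
  proof (induction w)
    case Nil
    then show ?case using a by simp
  next
    case (Cons l w)
    then have lw: "l < n" "w \<in> words n k'" "w \<in> words n k" by (auto simp: words_def k)
    then have "word_eval r X w \<in> carrier_mat r r"
      by (intro word_eval_carrier[OF X(1)]) (auto simp: words_def)
    then show ?case
      using Cons lw X(1)[of l] a[OF Nil(2)] by (simp add: assoc_mult_mat_vec[of _ r r _ r] X_a)
  qed
  interpret tracial_representation r N0 G0 D n X R "a []" W0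
  proof
    fix l i assume li: "l < n" "i < n"
    \<comment> \<open>Tested on spanning vectors, the two sides are values of \<open>y\<close> at
      cyclically equivalent words. Their degree is at most \<open>2 * (k - 1) + 2 = 2 * k\<close>,
      just within the order of \<open>y\<close>.\<close>
    show "X l * R i = R i * X l"
    proof (rule sc.mat_eqI)
      fix p q assume pq: "p < N0" "q < N0"
      let ?p = "W0 ! p" and ?q = "W0 ! q"
      note w = W0_words[OF pq(1)] W0_words[OF pq(2)]
      have ac: "a ?p \<in> carrier_vec r" "a ?q \<in> carrier_vec r" "a (?q @ [i]) \<in> carrier_vec r"
        "a (l # ?q) \<in> carrier_vec r"
        using w li by (auto intro: a short)
      note c = X[OF li(1)] R[OF li(2)]
      have "col G0 p \<bullet> ((X l * R i) *\<^sub>v col G0 q) = a (l # ?p) \<bullet> a (?q @ [i])"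
        using c ac w li pq
        by (simp add: col_G0 assoc_mult_mat_vec[of _ r r _ r] transpose_vec_mult_scalar[OF c(1) ac(3,1), symmetric] X_a)
      also have "\<dots> = y ((rev ?p @ l # ?q) @ [i])"
        using w li by (simp add: inner short)
      also have "\<dots> = y ([i] @ (rev ?p @ l # ?q))"
        using w li by (intro y_rotate) (auto simp: words_def k)
      also have "\<dots> = a (?p @ [i]) \<bullet> a (l # ?q)"
        using w li by (simp add: inner short)
      also have "\<dots> = col G0 p \<bullet> ((R i * X l) *\<^sub>v col G0 q)"
        using c ac w li pq
        by (simp add: col_G0 assoc_mult_mat_vec[of _ r r _ r] transpose_vec_mult_scalar[OF c(3) ac(4,1), symmetric] X_a)
      finally show "col G0 p \<bullet> ((X l * R i) *\<^sub>v col G0 q) = col G0 p \<bullet> ((R i * X l) *\<^sub>v col G0 q)" .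
    qed (use X(1)[OF li(1)] R(1)[OF li(2)] in simp_all)
  next
    show "\<And>j. j < N0 \<Longrightarrow> col G0 j = word_eval r X (W0 ! j) *\<^sub>v a []"
      using W0_words by (simp add: col_G0 eval words_def k le_SucI)
    show "\<And>l. l < n \<Longrightarrow> X l *\<^sub>v a [] = R l *\<^sub>v a []"
      using X_a Nil(1) by simp
    show "\<And>j. j < N0 \<Longrightarrow> set (W0 ! j) \<subseteq> {..<n}"
      using W0_words by (simp add: words_def)
    show "\<exists>j<N0. W0 ! j = []"
      using Nil(1) mem_W0 by blast
  qed (use X R a Nil in simp_all)
  \<comment> \<open>A word of degree up to \<open>2 * k\<close> is cut into two pieces of degree at
    most \<open>k\<close>; the Gram property gives \<open>y w\<close> as the product of
    \<open>a (rev u)\<close> and \<open>a v\<close>, and transposition brings \<open>u\<close> to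
    the other side.\<close>
  have y_eq: "y w = a [] \<bullet> (word_eval r X w *\<^sub>v a [])" if w: "w \<in> words n (2 * k)" for w
  proof -
    define u v where "u = take k w" and "v = drop k w"
    have uv: "w = u @ v" by (simp add: u_def v_def)
    have "u \<in> words n k" "rev u \<in> words n k" "v \<in> words n k"
      using w by (auto simp: words_def u_def v_def dest: in_set_takeD in_set_dropD)
    moreover from this have sets: "set u \<subseteq> {..<n}" "set v \<subseteq> {..<n}" by (auto simp: words_def)
    moreover have c: "left u \<in> carrier_mat r r" "left v \<in> carrier_mat r r"
      using sets by (auto intro: left_carrier)
    ultimately have "y w = (left (rev u) *\<^sub>v a []) \<bullet> (left v *\<^sub>v a [])"
      by (simp add: eval inner uv)
    also have "\<dots> = a [] \<bullet> (left u *\<^sub>v (left v *\<^sub>v a []))"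
      unfolding left_transpose[OF sets(1), symmetric]
      using a[OF Nil(2)] c by (intro transpose_vec_mult_scalar[of _ r r]) auto
    finally show ?thesis
      using a[OF Nil(2)] c sets by (simp add: uv left_append assoc_mult_mat_vec[of _ r r _ r])
  qed
  have "a [] \<bullet> a [] = 1"
    using inner[OF Nil(2) Nil(2)] assms(2) by (simp add: truncated_tracial_sequence_def)
  from tracial_mixture[OF this] show ?thesis
  proof (elim exE conjE)
    fix N' s :: nat and c :: "nat \<Rightarrow> real" and A
    assume mixture: "1 \<le> N'" "1 \<le> s" "\<forall>i \<in> {1..N'}. 0 \<le> c i" "(\<Sum>i = 1..N'. c i) = 1"
      "\<forall>i \<in> {1..N'}. \<forall>l<n. A i l \<in> carrier_mat s s \<and> symmetric_mat (A i l)"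
      "\<forall>w. set w \<subseteq> {..<n} \<longrightarrow>
         a [] \<bullet> (left w *\<^sub>v a []) = (\<Sum>i = 1..N'. c i * normalized_trace (word_eval s (A i) w))"
    have y_mix: "\<forall>w \<in> words n (2 * k). y w = (\<Sum>i = 1..N'. c i * normalized_trace (word_eval s (A i) w))"
      using y_eq mixture(6) by (simp add: words_def)
    show ?thesis
      unfolding truncated_tracial_moment_sequence_def
      by (rule conjI[OF assms(2)], rule exI[of _ N'], rule exI[of _ s], rule exI[of _ c],
          rule exI[of _ A]) (intro conjI mixture(1-5) y_mix)
  qed
qed

end
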